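(* Let $1\le m<n$ and let $T_n\in\mathbb{R}^{n\times n}$ be a symmetric matrix of the form $$T_n=\begin{bmatrix}T_m & 0\\ 0& \star\end{bmatrix}+\beta\begin{bmatrix}0& e_me_1^{\mathsf T}\\ e_1e_m^{\mathsf T}&0\end{bmatrix},$$ with $T_m\in\mathbb{R}^{m\times m}$ and $\beta\in\mathbb{R}$ (here $e_m\in\mathbb{R}^m$ is the last and $e_1\in\mathbb{R}^{n-m}$ the first unit vector, and $\star$ is an arbitrary symmetric block). Let $s_1,\dots,s_m\in\mathbb{R}^m$ be orthonormal eigenvectors belonging to the eigenvalues $\theta_1\le\cdots\le\theta_m$ of $T_m$, and let $W_k\in\mathbb{R}^{n\times k}$ contain orthonormal eigenvectors belonging to the smallest $k$ eigenvalues $\lambda_1\le\cdots\le\lambda_k$ of $T_n$. Given $0<\mathrm{tol}_{\mathrm{ra}}<1$ and $k\le\widehat k\le m-1$ such that $\theta_k<\theta_{\widehat k+1}$, set $\tau=(\theta_k+\theta_{\widehat k+1})/2$ and let $r_\tau=p/q$ be a real rational function with poles $\Xi_{\widehat k}$, such that no zero of $q$ is an eigenvalue of $T_m$ or of $T_n$, and satisfying $$|r_\tau(x)-\chi_\tau(x)|<\mathrm{tol}_{\mathrm{ra}}\quad\text{for every } x\in[\lambda_1,\theta_m]\setminus(\theta_k,\theta_{\widehat k+1}).$$ Let $V_\ell$ be a matrix whose columns form an orthonormal basis of $\mathrm{span}\{s_1,\dots,s_{\widehat k}\}+\mathcal{Q}(T_m,e_m,\Xi_{\widehat k})$. Then $$\|(I-PP^{\mathsf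 T})W_k\|<2\cdot\mathrm{tol}_{\mathrm{ra}}\qquad\text{with}\qquad P=\mathrm{diag}(V_\ell,I),$$ where $I$ in the definition of $P$ is the $(n-m)\times(n-m)$ identity matrix.
   Context: $\|\cdot\|$ is the spectral norm. $\chi_\tau$ is the step function $\chi_\tau(x)=1$ if $x<\tau$ and $\chi_\tau(x)=0$ otherwise. For a real rational function $r=p/q$ with polynomials $p,q$, the extended list of poles $\Xi$ (with entries in $\mathbb{C}\cup\{\infty\}$) consists of the zeros of $q$ with multiplicities, supplemented by infinite poles; its cardinality is counted as $|\Xi|:=\max\{\deg p,\deg q\}+1$. The rational Krylov subspace associated with a symmetric matrix $T_m\in\mathbb{R}^{m\times m}$, the vector $e_m$ and $\Xi$ is $$\mathcal{Q}(T_m,e_m,\Xi)=\{r(T_m)e_m: r \text{ is a rational function with poles } \Xi\}=\{\,\widetilde p(T_m)q(T_m)^{-1}e_m:\ \widetilde p \text{ a real polynomial},\ \deg\widetilde p\le\max\{\deg p,\deg q\}\}\subset\mathbb{R}^m .$$ Standing assumption: $|\Xi|\le m$ and $\mathcal{Q}(T_m,e_m,\Xi)$ has (its generic) dimension $|\Xi|$. *)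

theory Defs
  imports
    Jordan_Normal_Form.Char_Poly
    Jordan_Normal_Form.Gauss_Jordan_Elimination
    Jordan_Normal_Form.VS_Connect
    Jordan_Normal_Form.DL_Rank
begin

(* The norm of a real matrix induced by the Euclidean vector norm. The closed unit ball, rather
   than the unit sphere, keeps the supremum over a nonempty set also for a matrix without columns. *)
definition spectral_norm :: "real mat \<Rightarrow> real" where
  "spectral_norm A =
     Sup {sqrt ((A *\<^sub>v x) \<bullet> (A *\<^sub>v x)) | x. x \<in> carrier_vec (dim_col A) \<and> x \<bullet> x \<le> 1}"

definition step_fun :: "real \<Rightarrow> real \<Rightarrow> real" where
  "step_fun \<tau> x = (if x < \<tau> then 1 else 0)"

definition orthonormal_cols :: "real mat \<Rightarrow> bool" where
  "orthonormal_cols A \<longleftrightarrow> transpose_mat A * A = 1\<^sub>m (dim_col A)"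

definition outer_prod :: "real vec \<Rightarrow> real vec \<Rightarrow> real mat" where
  "outer_prod u v = mat (dim_vec u) (dim_vec v) (\<lambda>(i, j). u $ i * v $ j)"

definition poly_mat :: "real poly \<Rightarrow> real mat \<Rightarrow> real mat" where
  "poly_mat f A = mat (dim_row A) (dim_row A) (\<lambda>ij. \<Sum>l\<le>degree f. coeff f l * (A ^\<^sub>m l) $$ ij)"

(* A rational function p / q is represented by the pair of polynomials p and q. Its extended list
   of poles has degree q finite entries, the complex zeros of q, and is filled up with infinite
   poles to length max (degree p) (degree q) + 1. *)
definition num_poles :: "real poly \<Rightarrow> real poly \<Rightarrow> nat" where
  "num_poles p q = max (degree p) (degree q) + 1"

(* the (mat_inverse ...) is the inverse only when q has no zero among the eigenvalues of T. *)
definition rational_krylov :: "real mat \<Rightarrow> real vec \<Rightarrow> real poly \<Rightarrow> real poly \<Rightarrow> real vec set" where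
  "rational_krylov T v p q =
     {(poly_mat f T * the (mat_inverse (poly_mat q T))) *\<^sub>v v | f.
        degree f \<le> max (degree p) (degree q)}"

abbreviation vec_span :: "nat \<Rightarrow> real vec set \<Rightarrow> real vec set" where
  "vec_span m \<equiv> LinearCombinations.module.span class_ring (module_vec TYPE(real) m)"

abbreviation vec_subspace_sum :: "nat \<Rightarrow> real vec set \<Rightarrow> real vec set \<Rightarrow> real vec set" where
  "vec_subspace_sum m \<equiv> LinearCombinations.module.submodule_sum (module_vec TYPE(real) m)"

abbreviation vec_subspace_dim :: "nat \<Rightarrow> real vec set \<Rightarrow> nat" where
  "vec_subspace_dim m U \<equiv>
     vectorspace.dim (class_ring :: real ring) ((module_vec TYPE(real) m)\<lparr>carrier := U\<rparr>)"

end

theory Submission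
  imports Defs "Jordan_Normal_Form.Schur_Decomposition" "HOL-Analysis.L2_Norm"
begin

text \<open>
  Let \<open>y\<close> be the first \<open>m\<close> entries of an eigenvector of \<open>T\<^sub>n\<close> for the eigenvalue \<open>\<mu>\<close>. Then
  \<open>(T\<^sub>m - \<mu>) y\<close> is a multiple of \<open>e\<^sub>m\<close>, and since \<open>q(\<mu>) p - p(\<mu>) q\<close> is divisible by
  \<open>t - \<mu>\<close>, the vector \<open>r(\<mu>) y - r(T\<^sub>m) y\<close> lies in the rational Krylov space. The complementary
  projection \<open>I - V V\<^sup>T\<close> therefore only sees \<open>(1 - r(\<mu>)) y\<close> and the part of
  \<open>r(T\<^sub>m) y\<close> along the eigenvectors \<open>s\<^sub>j\<close> with \<open>j\<close> beyond \<open>khat\<close>. Both contributions are small, because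
  interlacing puts \<open>\<lambda>\<^sub>1, \<dots>, \<lambda>\<^sub>k\<close> and the remaining \<open>\<theta>\<^sub>j\<close> into the region where \<open>r\<close>
  approximates the step function.
\<close>

section \<open>Orthogonal diagonalization of real symmetric matrices\<close>

text \<open>Gram-Schmidt is run on a basis that starts with \<open>v\<close>. It leaves its first
  vector unchanged, and since \<open>v\<close> has norm 1 the final normalization leaves it
  unchanged too.\<close>

lemma orthonormal_completion:
  fixes v :: "real vec"
  assumes v: "v \<in> carrier_vec n" and vv: "v \<bullet> v = 1"
  shows "\<exists>U\<in>carrier_mat n n. transpose_mat U * U = 1\<^sub>m n \<and> col U 0 = v"
proof -
  interpret cof_vec_space n "TYPE(real)" .
  have v0: "v \<noteq> 0\<^sub>v n" using vv v by auto
  have n: "n \<noteq> 0" using v vv by (cases n) (auto simp: scalar_prod_def)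
  define b where "b = basis_completion v"
  define ws where "ws = gram_schmidt n b"
  note b = basis_completion[OF v v0, folded b_def]
  from b(6,7) n obtain vs where bv: "b = v # vs" by (cases b) auto
  from gram_schmidt_result[OF b(2,4,5) ws_def]
  have ws: "set ws \<subseteq> carrier_vec n" "corthogonal ws" "length ws = n"
    by (auto simp: b(6))
  have hdws: "ws ! 0 = v"
    using gram_schmidt_hd[OF v, of vs, folded bv] ws(3) n
    by (metis hd_conv_nth length_0_conv ws_def)
  \<comment> \<open>\<open>gram_schmidt\<close> gives orthogonal vectors of any positive length, so
    they still have to be scaled.\<close>
  define us where "us = map (\<lambda>w. (1 / sqrt (w \<bullet> w)) \<cdot>\<^sub>v w) ws"
  define U where "U = mat_of_cols n us"
  have conj: "conjugate w = w" for w :: "real vec"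
    by (intro eq_vecI) auto
  have wi: "ws ! i \<in> carrier_vec n" if "i < n" for i
    using ws that by auto
  have orth: "ws ! i \<bullet> ws ! j = 0 \<longleftrightarrow> i \<noteq> j" if "i < n" "j < n" for i j
    using corthogonalD[OF ws(2)] that ws(3) by (simp add: conj)
  have colU: "col U i = (1 / sqrt (ws ! i \<bullet> ws ! i)) \<cdot>\<^sub>v (ws ! i)" if "i < n" for i
    using that wi[OF that] ws(3) unfolding U_def us_def by (subst col_mat_of_cols) auto
  have U: "U \<in> carrier_mat n n"
    unfolding U_def us_def using ws(3) by auto
  have "transpose_mat U * U = 1\<^sub>m n"
  proof (rule eq_matI)
    fix i j assume "i < dim_row (1\<^sub>m n :: real mat)" "j < dim_col (1\<^sub>m n :: real mat)"
    then have ij: "i < n" "j < n" by auto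
    have pos: "ws ! i \<bullet> ws ! i \<ge> 0" 
      unfolding scalar_prod_def by (intro sum_nonneg) auto
    then have pos: "ws ! i \<bullet> ws ! i > 0" using orth[of i i] ij by force
    have "(transpose_mat U * U) $$ (i, j) = col U i \<bullet> col U j"
      using ij U by simp
    also have "\<dots> = 1\<^sub>m n $$ (i, j)"
      using orth[OF ij] ij wi[OF ij(1)] wi[OF ij(2)] pos by (auto simp: colU)
    finally show "(transpose_mat U * U) $$ (i, j) = 1\<^sub>m n $$ (i, j)" .
  qed (use U in auto)
  moreover have "col U 0 = v" using colU[of 0] n hdws vv by simp
  ultimately show ?thesis using U by blast
qed

text \<open>The spectral theorem by deflation, with induction on the list of roots. The
  factorization supplies the next real eigenvalue in each step and also prescribes the order in
  which the eigenvalues appear on the diagonal.\<close>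

lemma symmetric_orthogonal_diagonalization:
  fixes A :: "real mat"
  assumes "A \<in> carrier_mat n n" and "transpose_mat A = A"
    and "char_poly A = (\<Prod>e\<leftarrow>es. [:- e, 1:])"
  shows "\<exists>U\<in>carrier_mat n n. transpose_mat U * U = 1\<^sub>m n
    \<and> transpose_mat U * A * U = mat_diag n (\<lambda>i. es ! i)"
  using assms
proof (induction es arbitrary: n A)
  case Nil
  then have "n = 0" using degree_monic_char_poly[of A n] by simp
  then show ?case using Nil(1) by (intro bexI[of _ "1\<^sub>m n"]) (auto intro!: eq_matI simp: mat_diag_def)
next
  case (Cons e es n A)
  note A = Cons.prems(1) and sym = Cons.prems(2) and cp = Cons.prems(3)
  have "degree (\<Prod>e\<leftarrow>e # es. [:- e, 1:]) = length (e # es)"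
    by (rule degree_linear_factors)
  then have n: "n = Suc (length es)" using degree_monic_char_poly[OF A] cp by simp
  define k where "k = length es"
  have n: "n = 1 + k" using n k_def by simp
  have "eigenvalue A e"
    unfolding eigenvalue_root_char_poly[OF A] cp by simp
  then obtain v' where v': "v' \<in> carrier_vec n" "v' \<noteq> 0\<^sub>v n" "A *\<^sub>v v' = e \<cdot>\<^sub>v v'"
    using A unfolding eigenvalue_def eigenvector_def by auto
  have conj: "conjugate v' = v'" by (intro eq_vecI) auto
  have "v' \<bullet> v' > 0" 
    using conjugate_square_greater_0_vec[OF v'(1)] v'(2) by (simp add: conj)
  define v where "v = (1 / sqrt (v' \<bullet> v')) \<cdot>\<^sub>v v'"
  have v: "v \<in> carrier_vec n" using v'(1) by (simp add: v_def)
  have vv: "v \<bullet> v = 1" using v'(1) \<open>v' \<bullet> v' > 0\<close> by (simp add: v_def)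
  have Av: "A *\<^sub>v v = e \<cdot>\<^sub>v v"
    using mult_mat_vec[OF A v'(1)] v'(3) by (simp add: v_def smult_smult_assoc mult.commute)
  obtain U where U: "U \<in> carrier_mat n n" "transpose_mat U * U = 1\<^sub>m n" "col U 0 = v"
    using orthonormal_completion[OF v vv] by blast
  let ?T = transpose_mat
  have UT: "?T U \<in> carrier_mat n n" using U by simp
  have UUT: "U * ?T U = 1\<^sub>m n" using mat_mult_left_right_inverse[OF UT U(1) U(2)] .
  define B where "B = ?T U * A * U"
  have B: "B \<in> carrier_mat n n" using U A by (simp add: B_def)
  have Bsym: "?T B = B"
    using U A sym by (simp add: B_def transpose_mult[of _ n n _ n] assoc_mult_mat[of _ n n _ n _ n])
  have simBA: "similar_mat B A"
    using U A UUT UT unfolding similar_mat_def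
    by (intro exI[of _ "?T U"] exI[of _ U] similar_mat_witI[of _ _ n]) (auto simp: B_def)
  \<comment> \<open>The columns of \<open>U\<close> are orthonormal and the first one is an
    eigenvector, so the first column of \<open>B\<close> is \<open>e\<close> times a unit vector.
    Symmetry carries this over to the first row, and \<open>B\<close> splits into a 1 by 1 block and
    \<open>B3\<close>.\<close>
  have B0: "B $$ (i, 0) = (if i = 0 then e else 0)" if i: "i < n" for i
  proof -
    have "B $$ (i, 0) = col U i \<bullet> col (A * U) 0"
      using i U A n unfolding B_def by (simp add: assoc_mult_mat[of _ n n _ n _ n])
    also have "col (A * U) 0 = e \<cdot>\<^sub>v v"
      using col_mult2[OF A U(1), of 0] n by (simp add: U(3) Av)
    also have "col U i \<bullet> (e \<cdot>\<^sub>v v) = e * (col U i \<bullet> v)"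
      using U v i by simp
    also have "col U i \<bullet> v = (?T U * U) $$ (i, 0)"
      unfolding U(3)[symmetric] using U(1) i n by simp
    also have "\<dots> = (if i = 0 then 1 else 0)" unfolding U(2) using i n by simp
    finally show ?thesis by auto
  qed
  have B0': "B $$ (0, i) = (if i = 0 then e else 0)" if i: "i < n" for i
    using B0[OF i] arg_cong[OF Bsym, of "\<lambda>M. M $$ (0, i)"] B i n by auto
  have Bij: "B $$ (j, i) = B $$ (i, j)" if "i < n" "j < n" for i j
    using arg_cong[OF Bsym, of "\<lambda>M. M $$ (i, j)"] B that by simp
  define B3 where "B3 = mat k k (\<lambda>(i, j). B $$ (Suc i, Suc j))"
  define B1 where "B1 = mat 1 1 (\<lambda>_. e)"
  have B3: "B3 \<in> carrier_mat k k" by (simp add: B3_def)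
  have B1: "B1 \<in> carrier_mat 1 1" by (simp add: B1_def)
  have Bblock: "B = four_block_mat B1 (0\<^sub>m 1 k) (0\<^sub>m k 1) B3"
    by (rule eq_matI) (use B B0 B0' n in \<open>auto simp: B1_def B3_def\<close>)
  have B3sym: "?T B3 = B3"
    by (rule eq_matI) (use Bij n in \<open>auto simp: B3_def\<close>)
  have "char_poly B = char_poly B1 * char_poly B3"
    unfolding Bblock by (rule char_poly_four_block_zeros_col[OF B1 _ B3]) simp
  moreover have "char_poly B1 = [:-e, 1:]"
    by (simp add: B1_def char_poly_defs det_def sign_def)
  \<comment> \<open>\<open>B\<close> is similar to \<open>A\<close>, so cancelling the linear factor
    of \<open>e\<close> leaves exactly the factorization that the induction hypothesis asks of
    \<open>B3\<close>.\<close>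
  moreover have "char_poly B = [:-e, 1:] * (\<Prod>e\<leftarrow>es. [:- e, 1:])"
    using char_poly_similar[OF simBA] cp by simp
  ultimately have "char_poly B3 = (\<Prod>e\<leftarrow>es. [:- e, 1:])"
    by (metis mult_cancel_left pCons_eq_0_iff zero_neq_one)
  from Cons.IH[OF B3 B3sym this] obtain U3
    where U3: "U3 \<in> carrier_mat k k" "?T U3 * U3 = 1\<^sub>m k" 
      "?T U3 * B3 * U3 = mat_diag k (\<lambda>i. es ! i)" by blast
  \<comment> \<open>\<open>F\<close> rotates only the orthogonal complement of \<open>v\<close>, so
    \<open>U * F\<close> keeps \<open>v\<close> as first column and diagonalizes the remaining
    block.\<close>
  define F where "F = four_block_mat (1\<^sub>m 1) (0\<^sub>m 1 k) (0\<^sub>m k 1) U3"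
  have F: "F \<in> carrier_mat n n" unfolding F_def n by (rule four_block_carrier_mat) (use U3 in auto)
  have FT: "?T F = four_block_mat (1\<^sub>m 1) (0\<^sub>m 1 k) (0\<^sub>m k 1) (?T U3)"
    unfolding F_def by (subst transpose_four_block_mat[of _ 1 1 _ k _ k]) (use U3 in auto)
  have mult: "four_block_mat X (0\<^sub>m 1 k) (0\<^sub>m k 1) Y * four_block_mat X' (0\<^sub>m 1 k) (0\<^sub>m k 1) Y'
      = four_block_mat (X * X') (0\<^sub>m 1 k) (0\<^sub>m k 1) (Y * Y')"
    if "X \<in> carrier_mat 1 1" "Y \<in> carrier_mat k k" "X' \<in> carrier_mat 1 1" "Y' \<in> carrier_mat k k"
    for X Y X' Y' :: "real mat"
    by (subst mult_four_block_mat[of _ 1 1 _ k _ k _ _ 1 _ k]) (use that in auto)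
  have FF: "?T F * F = 1\<^sub>m n"
    unfolding FT unfolding F_def n using U3 by (subst mult) auto
  have "?T F * B * F = four_block_mat B1 (0\<^sub>m 1 k) (0\<^sub>m k 1) (?T U3 * B3 * U3)"
    unfolding FT Bblock unfolding F_def using U3(1) B1 B3
    by (simp add: mult[unfolded One_nat_def])
  also have "\<dots> = mat_diag n (\<lambda>i. (e # es) ! i)"
    unfolding U3(3) by (rule eq_matI) (auto simp: B1_def n mat_diag_def)
  finally have FBF: "?T F * B * F = mat_diag n (\<lambda>i. (e # es) ! i)" .
  have 1: "?T (U * F) = ?T F * ?T U" using U F by (simp add: transpose_mult[of _ n n _ n])
  have 2: "?T (U * F) * (U * F) = ?T F * (?T U * U) * F" 
    unfolding 1 using U(1) F by (simp add: assoc_mult_mat[of _ n n _ n _ n])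
  have 3: "?T (U * F) * A * (U * F) = ?T F * B * F"
    unfolding 1 B_def using U F A by (simp add: assoc_mult_mat[of _ n n _ n _ n])
  have "?T (U * F) * (U * F) = 1\<^sub>m n" using 2 F FF by (simp add: U(2))
  then show ?case
    using U(1) F 3 FBF by (intro bexI[of _ "U * F"]) auto
qed

section \<open>Norm estimates for orthonormal columns and diagonal matrices\<close>

lemma l2norm_triangle:
  fixes v w :: "real vec"
  assumes "v \<in> carrier_vec n" "w \<in> carrier_vec n"
  shows "sqrt ((v + w) \<bullet> (v + w)) \<le> sqrt (v \<bullet> v) + sqrt (w \<bullet> w)"
proof -
  have *: "sqrt (u \<bullet> u) = L2_set (\<lambda>i. u $ i) {0..<n}" if "u \<in> carrier_vec n" for u :: "real vec"
    using that by (simp add: scalar_prod_def L2_set_def power2_eq_square)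
  have "L2_set (\<lambda>i. (v + w) $ i) {0..<n} = L2_set (\<lambda>i. v $ i + w $ i) {0..<n}"
    using assms by (intro L2_set_cong) auto
  then show ?thesis using assms L2_set_triangle_ineq[of "\<lambda>i. v $ i" "\<lambda>i. w $ i" "{0..<n}"]
    by (simp add: * del: index_add_vec)
qed

lemma scalar_prod_self_nonneg: "0 \<le> v \<bullet> (v :: real vec)"
  unfolding scalar_prod_def by (intro sum_nonneg) auto

lemma scalar_prod_mult_mat_vec:
  fixes A B :: "real mat"
  assumes "A \<in> carrier_mat n k" "v \<in> carrier_vec k" "B \<in> carrier_mat n l" "w \<in> carrier_vec l"
  shows "(A *\<^sub>v v) \<bullet> (B *\<^sub>v w) = v \<bullet> ((transpose_mat A * B) *\<^sub>v w)"
  using assms transpose_vec_mult_scalar[of A n k v "B *\<^sub>v w"]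
  by (simp add: comm_scalar_prod[of v k] comm_scalar_prod[of "A *\<^sub>v v" n])

lemma isometry_scalar_prod:
  fixes A :: "real mat"
  assumes "A \<in> carrier_mat n k" "transpose_mat A * A = 1\<^sub>m k" "v \<in> carrier_vec k"
  shows "(A *\<^sub>v v) \<bullet> (A *\<^sub>v v) = v \<bullet> v"
  using assms by (simp add: scalar_prod_mult_mat_vec)

text \<open>Pythagoras: the squared norm of \<open>R *\<^sub>v u\<close> is that of \<open>u\<close>
  minus that of the coefficient vector \<open>t\<close> of the projection.\<close>

lemma projection_complement_contracts:
  fixes V :: "real mat"
  assumes V: "V \<in> carrier_mat m l" "transpose_mat V * V = 1\<^sub>m l" and u: "u \<in> carrier_vec m"
  defines "R \<equiv> 1\<^sub>m m - V * transpose_mat V"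
  shows "(R *\<^sub>v u) \<bullet> (R *\<^sub>v u) \<le> u \<bullet> u"
proof -
  define t where "t = transpose_mat V *\<^sub>v u"
  have t: "t \<in> carrier_vec l" using V u by (simp add: t_def)
  have Vt: "V *\<^sub>v t \<in> carrier_vec m" using V u by (simp add: t_def)
  have R: "R *\<^sub>v u = u - V *\<^sub>v t"
    using V u unfolding R_def t_def by (subst minus_mult_distrib_mat_vec[of _ m m]) auto
  have "u \<bullet> (V *\<^sub>v t) = t \<bullet> t"
    using transpose_vec_mult_scalar[OF V(1) t u] unfolding t_def
    by (simp add: t_def[symmetric])
  moreover have "(V *\<^sub>v t) \<bullet> u = u \<bullet> (V *\<^sub>v t)" using Vt u by (rule comm_scalar_prod)
  ultimately have "(R *\<^sub>v u) \<bullet> (R *\<^sub>v u) = u \<bullet> u - t \<bullet> t"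
    using u Vt isometry_scalar_prod[OF V t]
    by (simp add: R minus_scalar_prod_distrib[of _ m] scalar_prod_minus_distrib[of _ m])
  then show ?thesis using scalar_prod_self_nonneg[of t] by simp
qed

lemma mat_diag_mult_vec:
  "v \<in> carrier_vec n \<Longrightarrow> mat_diag n f *\<^sub>v v = vec n (\<lambda>i. f i * v $ i)" for v :: "real vec"
  by (rule eq_vecI) (auto simp: mat_diag_def scalar_prod_def if_distrib[of "\<lambda>x. x * _"] cong: if_cong)

lemma mat_diag_l2norm_le:
  fixes v :: "real vec"
  assumes v: "v \<in> carrier_vec n" and f: "\<And>i. i < n \<Longrightarrow> \<bar>f i\<bar> \<le> c" and c: "0 \<le> c"
  shows "sqrt ((mat_diag n f *\<^sub>v v) \<bullet> (mat_diag n f *\<^sub>v v)) \<le> c * sqrt (v \<bullet> v)"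
proof -
  have "(mat_diag n f *\<^sub>v v) \<bullet> (mat_diag n f *\<^sub>v v) = (\<Sum>i = 0..<n. (f i)\<^sup>2 * (v $ i)\<^sup>2)"
    using v by (simp add: mat_diag_mult_vec scalar_prod_def power2_eq_square algebra_simps)
  also have "\<dots> \<le> (\<Sum>i = 0..<n. c\<^sup>2 * (v $ i)\<^sup>2)"
    using f c by (intro sum_mono mult_right_mono) (auto simp: abs_le_square_iff[symmetric])
  also have "\<dots> = c\<^sup>2 * (v \<bullet> v)"
    using v by (simp add: scalar_prod_def sum_distrib_left power2_eq_square)
  finally show ?thesis using c real_sqrt_le_mono by (fastforce simp: real_sqrt_mult)
qed

section \<open>Eigenvalues of compressions\<close>

text \<open>A Courant-Fischer argument. By dimension, the span of the first \<open>j + 1\<close>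
  columns of \<open>Q\<close> contains a nonzero vector orthogonal to the first \<open>j\<close>
  columns of \<open>U\<close>. Its Rayleigh quotient is at least \<open>lam j\<close> by the
  orthogonality and at most \<open>\<theta> j\<close> by its position in the span.\<close>

lemma eigenvalue_compression_le:
  fixes T U Q :: "real mat" and lam \<theta> :: "nat \<Rightarrow> real"
  assumes T: "T \<in> carrier_mat n n"
    and U: "U \<in> carrier_mat n n" "transpose_mat U * U = 1\<^sub>m n"
      "transpose_mat U * T * U = mat_diag n lam"
    and Q: "Q \<in> carrier_mat n m" "transpose_mat Q * Q = 1\<^sub>m m"
      "transpose_mat Q * T * Q = mat_diag m \<theta>"
    and lam: "mono_on {..<n} lam" and \<theta>: "mono_on {..<m} \<theta>" and j: "j < m" "j < n"
  shows "lam j \<le> \<theta> j"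
proof -
  \<comment> \<open>\<open>G\<close> holds the coordinates of the columns of \<open>Q\<close> in the
    eigenbasis \<open>U\<close>; in these coordinates \<open>T\<close> becomes
    \<open>mat_diag n lam\<close>.\<close>
  define G where "G = transpose_mat U * Q"
  have G: "G \<in> carrier_mat n m" using U Q by (simp add: G_def)
  have UT: "transpose_mat U \<in> carrier_mat n n" using U by simp
  have UUT: "U * transpose_mat U = 1\<^sub>m n"
    using mat_mult_left_right_inverse[OF UT U(1) U(2)] .
  have GT: "transpose_mat G = transpose_mat Q * U"
    using U Q by (simp add: G_def transpose_mult[of _ n n _ m])
  have GG: "transpose_mat G * G = 1\<^sub>m m"
  proof -
    have "transpose_mat G * G = transpose_mat Q * (U * transpose_mat U) * Q"
      unfolding GT unfolding G_def using U Q by (simp add: assoc_mult_mat[of _ m n _ n _ m]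
        assoc_mult_mat[of _ n n _ n _ m] assoc_mult_mat[of _ m n _ n _ n])
    then show ?thesis using Q by (simp add: UUT)
  qed
  have "transpose_mat G * (mat_diag n lam * G)
      = transpose_mat Q * ((U * transpose_mat U) * T * (U * transpose_mat U)) * Q"
    unfolding GT unfolding G_def U(3)[symmetric] using U(1) Q(1) T
    by (simp add: assoc_mult_mat[of _ m n _ n _ m] assoc_mult_mat[of _ n n _ n _ n]
        assoc_mult_mat[of _ n n _ n _ m] assoc_mult_mat[of _ m n _ n _ n])
  then have GDG: "transpose_mat G * (mat_diag n lam * G) = mat_diag m \<theta>"
    using T by (simp add: UUT Q(3))
  \<comment> \<open>The zero last row makes \<open>M\<close> singular: a kernel vector combines the first \<open>j + 1\<close> columns
    of \<open>Q\<close> into a vector orthogonal to the first \<open>j\<close> columns of \<open>U\<close>.\<close>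
  define M where "M = mat (Suc j) (Suc j) (\<lambda>(i, l). if i < j then G $$ (i, l) else 0)"
  have M: "M \<in> carrier_mat (Suc j) (Suc j)" by (simp add: M_def)
  have "\<exists>c. c \<in> carrier_vec (Suc j) \<and> c \<noteq> 0\<^sub>v (Suc j) \<and> M *\<^sub>v c = 0\<^sub>v (Suc j)"
  proof (rule ccontr)
    assume "\<not> ?thesis"
    then have "det M \<noteq> 0" using det_0_iff_vec_prod_zero[OF M] by blast
    then have "det (transpose_mat M) \<noteq> 0" using det_transpose[OF M] by simp
    moreover have "transpose_mat M *\<^sub>v unit_vec (Suc j) j = 0\<^sub>v (Suc j)"
      by (rule eq_vecI) (auto simp: M_def)
    moreover have "unit_vec (Suc j) j \<noteq> (0\<^sub>v (Suc j) :: real vec)"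
      by (metis index_unit_vec(2) index_zero_vec(1) lessI zero_neq_one)
    ultimately show False using det_0_iff_vec_prod_zero[of "transpose_mat M" "Suc j"] M
      by (metis transpose_carrier_mat unit_vec_carrier)
  qed
  then obtain c where c: "c \<in> carrier_vec (Suc j)" "c \<noteq> 0\<^sub>v (Suc j)" "M *\<^sub>v c = 0\<^sub>v (Suc j)"
    by blast
  \<comment> \<open>Padding with zeros turns the kernel vector into coefficients for all columns of
    \<open>Q\<close>; only those up to index \<open>j\<close> take part.\<close>
  define d where "d = vec m (\<lambda>l. if l \<le> j then c $ l else 0)"
  have d: "d \<in> carrier_vec m" by (simp add: d_def)
  have dd: "d \<bullet> d > 0"
  proof -
    obtain i where i: "i \<le> j" "c $ i \<noteq> 0" using c(1,2) by (metis carrier_vecD eq_vecI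
      index_zero_vec(1) index_zero_vec(2) less_Suc_eq_le)
    have "0 < d $ i * d $ i" using i j by (simp add: d_def) (metis not_square_less_zero linorder_neqE_linordered_idom mult_eq_0_iff)
    also have "\<dots> \<le> d \<bullet> d"
      unfolding scalar_prod_def using i j d 
      by (intro member_le_sum[of i _ "\<lambda>i. d $ i * d $ i"]) auto
    finally show ?thesis .
  qed
  define a where "a = G *\<^sub>v d"
  have a: "a \<in> carrier_vec n" using G d by (simp add: a_def)
  have a0: "a $ i = 0" if i: "i < j" for i
  proof -
    have "a $ i = (\<Sum>l = 0..<m. G $$ (i, l) * d $ l)"
      using i j G d by (simp add: a_def scalar_prod_def)
    also have "\<dots> = (\<Sum>l = 0..<Suc j. G $$ (i, l) * d $ l)"
      using j by (intro sum.mono_neutral_right) (auto simp: d_def)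
    also have "\<dots> = (\<Sum>l = 0..<Suc j. M $$ (i, l) * c $ l)"
      using j i by (intro sum.cong) (auto simp: d_def M_def)
    also have "\<dots> = (M *\<^sub>v c) $ i" using i c(1) M by (simp add: scalar_prod_def)
    finally show ?thesis using c(3) i by simp
  qed
  have aa: "a \<bullet> a = d \<bullet> d" unfolding a_def by (rule isometry_scalar_prod[OF G GG d])
  have "a \<bullet> (mat_diag n lam *\<^sub>v a) = d \<bullet> (mat_diag m \<theta> *\<^sub>v d)"
  proof -
    have "mat_diag n lam *\<^sub>v a = (mat_diag n lam * G) *\<^sub>v d"
      using G d by (simp add: a_def assoc_mult_mat_vec[of _ n n _ m])
    moreover have "mat_diag n lam * G \<in> carrier_mat n m"
      using G by (intro mult_carrier_mat[of _ n n]) auto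
    ultimately show ?thesis using scalar_prod_mult_mat_vec[OF G d, of "mat_diag n lam * G" m d] G d
      by (simp add: a_def GDG)
  qed
  moreover have "a \<bullet> (mat_diag n lam *\<^sub>v a) = (\<Sum>i = 0..<n. lam i * (a $ i)\<^sup>2)"
    using a by (simp add: mat_diag_mult_vec scalar_prod_def power2_eq_square algebra_simps)
  \<comment> \<open>Here \<open>a\<close> vanishes below index \<open>j\<close>, so only eigenvalues
    from \<open>lam j\<close> upwards carry weight. The later upper estimate is the mirror image:
    \<open>d\<close> vanishes above index \<open>j\<close>.\<close>
  moreover have "(\<Sum>i = 0..<n. lam i * (a $ i)\<^sup>2) \<ge> (\<Sum>i = 0..<n. lam j * (a $ i)\<^sup>2)"
  proof (rule sum_mono)
    fix i assume i: "i \<in> {0..<n}"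
    show "lam j * (a $ i)\<^sup>2 \<le> lam i * (a $ i)\<^sup>2"
    proof (cases "i < j")
      case False
      then have "lam j \<le> lam i" using i j lam by (intro mono_onD[OF lam]) auto
      then show ?thesis by (rule mult_right_mono) simp
    qed (simp add: a0)
  qed
  moreover have "(\<Sum>i = 0..<n. lam j * (a $ i)\<^sup>2) = lam j * (a \<bullet> a)"
    using a by (simp add: scalar_prod_def sum_distrib_left power2_eq_square)
  moreover have "d \<bullet> (mat_diag m \<theta> *\<^sub>v d) = (\<Sum>i = 0..<m. \<theta> i * (d $ i)\<^sup>2)"
    using d by (simp add: mat_diag_mult_vec scalar_prod_def power2_eq_square algebra_simps)
  moreover have "(\<Sum>i = 0..<m. \<theta> i * (d $ i)\<^sup>2) \<le> (\<Sum>i = 0..<m. \<theta> j * (d $ i)\<^sup>2)"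
  proof (rule sum_mono)
    fix i assume i: "i \<in> {0..<m}"
    show "\<theta> i * (d $ i)\<^sup>2 \<le> \<theta> j * (d $ i)\<^sup>2"
    proof (cases "i \<le> j")
      case True
      then have "\<theta> i \<le> \<theta> j" using i j by (intro mono_onD[OF \<theta>]) auto
      then show ?thesis by (rule mult_right_mono) simp
    qed (use i in \<open>simp add: d_def\<close>)
  qed
  moreover have "(\<Sum>i = 0..<m. \<theta> j * (d $ i)\<^sup>2) = \<theta> j * (d \<bullet> d)"
    using d by (simp add: scalar_prod_def sum_distrib_left power2_eq_square)
  ultimately have "lam j * (d \<bullet> d) \<le> \<theta> j * (d \<bullet> d)" by (simp add: aa)
  then show ?thesis using dd by simp
qed

section \<open>Rational functions of a diagonalized matrix and the Krylov space\<close>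

lemma poly_mat_carrier [simp]: "A \<in> carrier_mat n n \<Longrightarrow> poly_mat f A \<in> carrier_mat n n"
  by (simp add: poly_mat_def)

text \<open>The intertwining relation passes to powers by induction and then to polynomials by
  linearity.\<close>

lemma poly_mat_diagonalized:
  assumes T: "T \<in> carrier_mat m m" and S: "S \<in> carrier_mat m m"
    and TS: "transpose_mat S * T = mat_diag m \<theta> * transpose_mat S"
  shows "transpose_mat S * poly_mat f T = mat_diag m (\<lambda>i. poly f (\<theta> i)) * transpose_mat S"
proof -
  have ST: "transpose_mat S \<in> carrier_mat m m" using S by simp
  have pow: "transpose_mat S * (T ^\<^sub>m l) = mat_diag m (\<lambda>i. \<theta> i ^ l) * transpose_mat S" for l
  proof (induction l)
    case 0
    then show ?case using T ST by (simp add: mat_diag_one)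
  next
    case (Suc l)
    have "transpose_mat S * (T ^\<^sub>m Suc l) = transpose_mat S * (T ^\<^sub>m l) * T"
      using T ST by (simp add: assoc_mult_mat[of _ m m _ m _ m] pow_carrier_mat)
    also have "\<dots> = mat_diag m (\<lambda>i. \<theta> i ^ l) * (transpose_mat S * T)"
      using T ST by (simp add: Suc.IH assoc_mult_mat[of _ m m _ m _ m])
    also have "\<dots> = mat_diag m (\<lambda>i. \<theta> i ^ l) * mat_diag m \<theta> * transpose_mat S"
      using ST unfolding TS by (simp add: assoc_mult_mat[of _ m m _ m _ m] del: mat_diag_diag)
    finally show ?case by (simp add: mult.commute)
  qed
  show ?thesis
  proof (rule eq_matI)
    fix i j
    assume "i < dim_row (mat_diag m (\<lambda>i. poly f (\<theta> i)) * transpose_mat S)"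
      and "j < dim_col (mat_diag m (\<lambda>i. poly f (\<theta> i)) * transpose_mat S)"
    then have ij: "i < m" "j < m" using S by (auto simp: mat_diag_def)
    have Tl: "T ^\<^sub>m l \<in> carrier_mat m m" for l using T by (simp add: pow_carrier_mat)
    have "(transpose_mat S * poly_mat f T) $$ (i, j)
        = (\<Sum>a = 0..<m. S $$ (a, i) * (\<Sum>l\<le>degree f. coeff f l * (T ^\<^sub>m l) $$ (a, j)))"
      using ij S T by (simp add: scalar_prod_def poly_mat_def)
    also have "\<dots> = (\<Sum>l\<le>degree f. coeff f l * (\<Sum>a = 0..<m. S $$ (a, i) * (T ^\<^sub>m l) $$ (a, j)))"
      unfolding sum_distrib_left by (subst sum.swap) (simp add: mult.left_commute)
    also have "\<dots> = (\<Sum>l\<le>degree f. coeff f l * (transpose_mat S * (T ^\<^sub>m l)) $$ (i, j))"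
      using ij S Tl[THEN carrier_matD(1)] Tl[THEN carrier_matD(2)]
      by (simp add: scalar_prod_def)
    also have "\<dots> = (\<Sum>l\<le>degree f. coeff f l * \<theta> i ^ l) * S $$ (j, i)"
      unfolding pow sum_distrib_right using ij S by (simp add: mat_diag_mult_left[OF ST] mult.assoc)
    also have "\<dots> = (mat_diag m (\<lambda>i. poly f (\<theta> i)) * transpose_mat S) $$ (i, j)"
      using ij S by (simp add: mat_diag_mult_left[OF ST] poly_altdef)
    finally show "(transpose_mat S * poly_mat f T) $$ (i, j)
        = (mat_diag m (\<lambda>i. poly f (\<theta> i)) * transpose_mat S) $$ (i, j)" .
  qed (use S T in \<open>auto simp: mat_diag_def poly_mat_def\<close>)
qed

text \<open>Since \<open>q\<close> does not vanish on the eigenvalues, \<open>mat_inverse\<close>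
  really returns an inverse, and \<open>the\<close> can be evaluated. Everything afterwards works
  with the spectral form on the right-hand side.\<close>

lemma rational_mat_diagonalized:
  assumes T: "T \<in> carrier_mat m m" and S: "S \<in> carrier_mat m m" "transpose_mat S * S = 1\<^sub>m m"
    and TS: "transpose_mat S * T = mat_diag m \<theta> * transpose_mat S"
    and q: "\<And>i. i < m \<Longrightarrow> poly q (\<theta> i) \<noteq> 0"
  shows "poly_mat f T * the (mat_inverse (poly_mat q T))
    = S * mat_diag m (\<lambda>i. poly f (\<theta> i) / poly q (\<theta> i)) * transpose_mat S"
proof -
  \<comment> \<open>The candidate for the inverse of \<open>poly_mat q T\<close>, obtained by
    inverting the eigenvalues.\<close>
  define C where "C = S * mat_diag m (\<lambda>i. 1 / poly q (\<theta> i)) * transpose_mat S"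
  have ST: "transpose_mat S \<in> carrier_mat m m" using S(1) by simp
  have D: "mat_diag m g \<in> carrier_mat m m" for g :: "nat \<Rightarrow> real" by simp
  note assoc = assoc_mult_mat[of _ m m _ m _ m]
  have SST: "S * transpose_mat S = 1\<^sub>m m"
    using mat_mult_left_right_inverse[OF ST S] .
  have fT: "poly_mat g T = S * mat_diag m (\<lambda>i. poly g (\<theta> i)) * transpose_mat S" for g
  proof -
    have "poly_mat g T = (S * transpose_mat S) * poly_mat g T"
      using left_mult_one_mat[OF poly_mat_carrier[OF T]] by (simp add: SST)
    also have "\<dots> = S * (transpose_mat S * poly_mat g T)"
      using S(1) T by (simp add: assoc)
    finally show ?thesis
      unfolding poly_mat_diagonalized[OF T S(1) TS] using S(1) by (simp add: assoc)
  qed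
  have "(S * G * transpose_mat S) * (S * H * transpose_mat S) = S * (G * H) * transpose_mat S"
    if "G \<in> carrier_mat m m" "H \<in> carrier_mat m m" for G H
  proof -
    note G = that(1) and H = that(2)
    have Y: "H * transpose_mat S \<in> carrier_mat m m" using H ST by (rule mult_carrier_mat)
    have X: "S * G \<in> carrier_mat m m" using S(1) G by (rule mult_carrier_mat)
    have "(S * G * transpose_mat S) * (S * H * transpose_mat S)
       = S * G * (transpose_mat S * (S * (H * transpose_mat S)))"
      unfolding assoc_mult_mat[OF S(1) H ST]
      by (rule assoc_mult_mat[OF X ST mult_carrier_mat[OF S(1) Y]])
    also have "transpose_mat S * (S * (H * transpose_mat S)) = H * transpose_mat S"
      using assoc_mult_mat[OF ST S(1) Y] left_mult_one_mat[OF Y] by (simp only: S(2))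
    also have "S * G * (H * transpose_mat S) = S * (G * H) * transpose_mat S"
      unfolding assoc_mult_mat[OF X H ST, symmetric] assoc_mult_mat[OF S(1) G H] ..
    finally show ?thesis .
  qed
  note conj_mult = this
  have diag: "(S * mat_diag m g * transpose_mat S) * (S * mat_diag m h * transpose_mat S)
     = S * mat_diag m (\<lambda>i. g i * h i) * transpose_mat S" for g h
    using conj_mult[OF D[of g] D[of h]] unfolding mat_diag_diag .
  have C: "C \<in> carrier_mat m m" 
    unfolding C_def by (rule mult_carrier_mat[OF mult_carrier_mat[OF S(1) D] ST])
  have one: "mat_diag m (\<lambda>i. poly q (\<theta> i) * (1 / poly q (\<theta> i))) = 1\<^sub>m m"
    using q by (intro eq_matI) (auto simp: mat_diag_def)
  have "poly_mat q T * C = S * mat_diag m (\<lambda>i. poly q (\<theta> i) * (1 / poly q (\<theta> i))) * transpose_mat S"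
    unfolding fT[of q] C_def by (rule diag)
  then have qC: "poly_mat q T * C = 1\<^sub>m m"
    by (simp only: one right_mult_one_mat[OF S(1)] SST)
  have "det (poly_mat q T) * det C = 1"
    using det_mult[OF poly_mat_carrier[OF T] C, of q] by (simp only: qC det_one)
  then have "det (poly_mat q T) \<noteq> 0" by auto
  then have "poly_mat q T \<in> Units (ring_mat TYPE(real) m ())"
    by (rule det_non_zero_imp_unit[OF poly_mat_carrier[OF T]])
  then have "mat_inverse (poly_mat q T) \<noteq> None"
    using mat_inverse(1)[OF poly_mat_carrier[OF T], where b = "()"] by auto
  then obtain B where B: "mat_inverse (poly_mat q T) = Some B" by (meson not_None_eq)
  have B': "B * poly_mat q T = 1\<^sub>m m" "B \<in> carrier_mat m m"
    using mat_inverse(2)[OF poly_mat_carrier[OF T] B] by auto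
  \<comment> \<open>Uniqueness of the inverse identifies the matrix that \<open>mat_inverse\<close>
    returns with the candidate \<open>C\<close>.\<close>
  have "B = B * (poly_mat q T * C)" unfolding qC right_mult_one_mat[OF B'(2)] ..
  also have "\<dots> = (B * poly_mat q T) * C"
    by (rule assoc_mult_mat[OF B'(2) poly_mat_carrier[OF T] C, symmetric])
  also have "\<dots> = C" unfolding B'(1) by (rule left_mult_one_mat[OF C])
  finally have "B = C" .
  then have "poly_mat f T * the (mat_inverse (poly_mat q T)) = poly_mat f T * C"
    by (simp only: B option.sel)
  also have "\<dots> = S * mat_diag m (\<lambda>i. poly f (\<theta> i) * (1 / poly q (\<theta> i))) * transpose_mat S"
    unfolding fT C_def by (rule diag)
  finally show ?thesis by simp
qed

lemma vec_eq_if_transpose_eq: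
  fixes S :: "real mat"
  assumes S: "S \<in> carrier_mat m m" "transpose_mat S * S = 1\<^sub>m m"
    and u: "u \<in> carrier_vec m" and v: "v \<in> carrier_vec m"
    and eq: "transpose_mat S *\<^sub>v u = transpose_mat S *\<^sub>v v"
  shows "u = v"
proof -
  have ST: "transpose_mat S \<in> carrier_mat m m" using S(1) by simp
  have SST: "S * transpose_mat S = 1\<^sub>m m"
    using mat_mult_left_right_inverse[OF ST S] .
  have "w = S *\<^sub>v (transpose_mat S *\<^sub>v w)" if "w \<in> carrier_vec m" for w
    using assoc_mult_mat_vec[OF S(1) ST that] that by (simp add: SST)
  then show ?thesis using u v eq by metis
qed

text \<open>In eigenbasis coordinates a function of the matrix acts entrywise. Together with
  \<open>vec_eq_if_transpose_eq\<close> this reduces vector identities to scalar ones.\<close>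

lemma transpose_diagonalized_mult_vec:
  fixes S :: "real mat"
  assumes S: "S \<in> carrier_mat m m" "transpose_mat S * S = 1\<^sub>m m" and v: "v \<in> carrier_vec m"
  shows "transpose_mat S *\<^sub>v ((S * mat_diag m g * transpose_mat S) *\<^sub>v v)
    = vec m (\<lambda>i. g i * (transpose_mat S *\<^sub>v v) $ i)"
proof -
  have ST: "transpose_mat S \<in> carrier_mat m m" using S(1) by simp
  have D: "mat_diag m g \<in> carrier_mat m m" by simp
  define z where "z = mat_diag m g *\<^sub>v (transpose_mat S *\<^sub>v v)"
  have z: "z \<in> carrier_vec m"
    unfolding z_def by (rule mult_mat_vec_carrier[OF D mult_mat_vec_carrier[OF ST v]])
  have "(S * mat_diag m g * transpose_mat S) *\<^sub>v v = S *\<^sub>v z"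
    unfolding z_def using S(1) D ST v by (simp add: assoc_mult_mat_vec[of _ m m _ m])
  then have "transpose_mat S *\<^sub>v ((S * mat_diag m g * transpose_mat S) *\<^sub>v v)
    = (transpose_mat S * S) *\<^sub>v z"
    using assoc_mult_mat_vec[OF ST S(1) z] by simp
  also have "\<dots> = mat_diag m g *\<^sub>v (transpose_mat S *\<^sub>v v)"
    unfolding S(2) using z by (simp add: z_def)
  also have "\<dots> = vec m (\<lambda>i. g i * (transpose_mat S *\<^sub>v v) $ i)"
    by (rule mat_diag_mult_vec[OF mult_mat_vec_carrier[OF ST v]])
  finally show ?thesis .
qed

text \<open>With \<open>h\<close> and \<open>g\<close> as in the proof, r(\<mu>) - r(t) = (\<mu> -
  t) g(t) / (q(\<mu>) q(t)). Applied to \<open>y\<close>, the factor \<mu> - t becomes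
  \<open>c\<close> times \<open>e\<close> by the hypothesis \<open>eig\<close>, and what remains is
  a rational function with denominator \<open>q\<close> applied to \<open>e\<close>.\<close>

lemma rational_residual_in_krylov:
  fixes T S :: "real mat"
  assumes T: "T \<in> carrier_mat m m" and S: "S \<in> carrier_mat m m" "transpose_mat S * S = 1\<^sub>m m"
    and TS: "transpose_mat S * T = mat_diag m \<theta> * transpose_mat S"
    and q: "\<And>i. i < m \<Longrightarrow> poly q (\<theta> i) \<noteq> 0" and q0: "poly q \<mu> \<noteq> 0"
    and y: "y \<in> carrier_vec m" and e: "e \<in> carrier_vec m"
    and eig: "T *\<^sub>v y + c \<cdot>\<^sub>v e = \<mu> \<cdot>\<^sub>v y"
  shows "(poly p \<mu> / poly q \<mu>) \<cdot>\<^sub>v y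
      - (S * mat_diag m (\<lambda>i. poly p (\<theta> i) / poly q (\<theta> i)) * transpose_mat S) *\<^sub>v y
      \<in> rational_krylov T e p q"
proof -
  have ST: "transpose_mat S \<in> carrier_mat m m" using S(1) by simp
  let ?R = "\<lambda>f. S * mat_diag m (\<lambda>i. poly f (\<theta> i) / poly q (\<theta> i)) * transpose_mat S"
  define h where "h = Polynomial.smult (poly q \<mu>) p - Polynomial.smult (poly p \<mu>) q"
  have "poly h \<mu> = 0" by (simp add: h_def)
  then obtain g where g: "h = [:-\<mu>, 1:] * g" by (auto simp: poly_eq_0_iff_dvd)
  \<comment> \<open>The quotient is zero when \<open>h\<close> is zero, for instance for constant r;
    the degree formula for products needs nonzero factors.\<close>
  have "degree g \<le> degree h"
  proof (cases "g = 0")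
    case False
    then show ?thesis unfolding g by (subst degree_mult_eq) auto
  qed simp
  also have "degree h \<le> max (degree p) (degree q)"
    unfolding h_def by (intro degree_diff_le) auto
  finally have deg: "degree g \<le> max (degree p) (degree q)" .
  \<comment> \<open>The numerator of the Krylov vector: the coupling coefficient \<open>c\<close>
    and the constant denominator q(\<mu>) are absorbed into \<open>g\<close>.\<close>
  define f where "f = Polynomial.smult (c / poly q \<mu>) g"
  have degf: "degree f \<le> max (degree p) (degree q)"
    using deg degree_smult_le[of "c / poly q \<mu>" g] unfolding f_def by linarith
  define yh where "yh = transpose_mat S *\<^sub>v y"
  define eh where "eh = transpose_mat S *\<^sub>v e"
  have yh: "yh \<in> carrier_vec m" and eh: "eh \<in> carrier_vec m"
    using ST y e by (auto simp: yh_def eh_def)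
  \<comment> \<open>The hypothesis \<open>eig\<close> in eigenbasis coordinates. It is never divided
    by \<mu> - \<open>\<theta> i\<close>, so \<mu> may itself be an eigenvalue of
    \<open>T\<close>.\<close>
  have coord: "(\<mu> - \<theta> i) * yh $ i = c * eh $ i" if i: "i < m" for i
  proof -
    have "transpose_mat S *\<^sub>v (T *\<^sub>v y + c \<cdot>\<^sub>v e) = (transpose_mat S * T) *\<^sub>v y + c \<cdot>\<^sub>v eh"
      using ST T y e unfolding eh_def
      by (simp add: mult_add_distrib_mat_vec[of _ m m] mult_mat_vec[of _ m m] assoc_mult_mat_vec[of _ m m _ m])
    also have "(transpose_mat S * T) *\<^sub>v y = vec m (\<lambda>i. \<theta> i * yh $ i)"
      unfolding TS yh_def using ST y
      by (subst assoc_mult_mat_vec[of _ m m _ m]) (auto simp: mat_diag_mult_vec)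
    finally have "vec m (\<lambda>i. \<theta> i * yh $ i) + c \<cdot>\<^sub>v eh = \<mu> \<cdot>\<^sub>v yh"
      unfolding eig yh_def using mult_mat_vec[OF ST y] by simp
    from arg_cong[OF this, of "\<lambda>v. v $ i"] show ?thesis
      using i yh eh by (simp add: algebra_simps)
  qed
  have R: "?R f \<in> carrier_mat m m" for f
    using ST by (intro mult_carrier_mat[of _ m m] S) auto
  have "(poly p \<mu> / poly q \<mu>) \<cdot>\<^sub>v y - ?R p *\<^sub>v y = ?R f *\<^sub>v e"
  proof (rule vec_eq_if_transpose_eq[OF S])
    have Rpy: "?R p *\<^sub>v y \<in> carrier_vec m" by (rule mult_mat_vec_carrier[OF R y])
    show "(poly p \<mu> / poly q \<mu>) \<cdot>\<^sub>v y - ?R p *\<^sub>v y \<in> carrier_vec m" using Rpy y by simp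
    show "?R f *\<^sub>v e \<in> carrier_vec m" by (rule mult_mat_vec_carrier[OF R e])
    have "transpose_mat S *\<^sub>v ((poly p \<mu> / poly q \<mu>) \<cdot>\<^sub>v y - ?R p *\<^sub>v y)
      = (poly p \<mu> / poly q \<mu>) \<cdot>\<^sub>v yh - transpose_mat S *\<^sub>v (?R p *\<^sub>v y)"
      unfolding yh_def using ST y Rpy
      by (simp add: mult_minus_distrib_mat_vec[of _ m m] mult_mat_vec[of _ m m])
    also have "\<dots> = transpose_mat S *\<^sub>v (?R f *\<^sub>v e)"
    proof (rule eq_vecI)
      fix i assume "i < dim_vec (transpose_mat S *\<^sub>v (?R f *\<^sub>v e))"
      then have i: "i < m" using S by simp
      have "poly h (\<theta> i) = (\<theta> i - \<mu>) * poly g (\<theta> i)" by (simp add: g algebra_simps)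
      then have hh: "poly q \<mu> * poly p (\<theta> i) - poly p \<mu> * poly q (\<theta> i) = (\<theta> i - \<mu>) * poly g (\<theta> i)"
        by (simp add: h_def)
      have "poly p \<mu> / poly q \<mu> - poly p (\<theta> i) / poly q (\<theta> i)
          = - (poly q \<mu> * poly p (\<theta> i) - poly p \<mu> * poly q (\<theta> i)) / (poly q \<mu> * poly q (\<theta> i))"
        using q[OF i] q0 by (simp add: field_simps)
      then have "(poly p \<mu> / poly q \<mu> - poly p (\<theta> i) / poly q (\<theta> i)) * yh $ i
          = poly g (\<theta> i) / (poly q \<mu> * poly q (\<theta> i)) * ((\<mu> - \<theta> i) * yh $ i)"
        unfolding hh by (simp add: field_simps)
      also have "\<dots> = poly f (\<theta> i) / poly q (\<theta> i) * eh $ i"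
        unfolding coord[OF i] by (simp add: f_def)
      finally show "((poly p \<mu> / poly q \<mu>) \<cdot>\<^sub>v yh - transpose_mat S *\<^sub>v (?R p *\<^sub>v y)) $ i
          = (transpose_mat S *\<^sub>v (?R f *\<^sub>v e)) $ i"
        unfolding transpose_diagonalized_mult_vec[OF S y] transpose_diagonalized_mult_vec[OF S e]
        using i yh unfolding yh_def[symmetric] eh_def[symmetric]
        by (simp add: algebra_simps)
    qed (use S yh in auto)
    finally show "transpose_mat S *\<^sub>v ((poly p \<mu> / poly q \<mu>) \<cdot>\<^sub>v y - ?R p *\<^sub>v y)
      = transpose_mat S *\<^sub>v (?R f *\<^sub>v e)" .
  qed
  also have "\<dots> = (poly_mat f T * the (mat_inverse (poly_mat q T))) *\<^sub>v e"
    by (simp only: rational_mat_diagonalized[OF T S TS q])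
  also have "\<dots> \<in> rational_krylov T e p q"
    unfolding rational_krylov_def using degf by blast
  finally show ?thesis .
qed

lemma vec_span_colsE:
  assumes V: "V \<in> carrier_mat m l" and v: "v \<in> vec_span m (set (cols V))"
  obtains c where "c \<in> carrier_vec l" "v = V *\<^sub>v c"
proof -
  interpret vec_space "TYPE(real)" m .
  show thesis using v that V unfolding col_space_def[symmetric] col_space_eq[OF V] by auto
qed

section \<open>Norm bound for the projected eigenvectors\<close>

text \<open>On each column, \<open>R\<close> sees a multiple 1 - \<open>\<sigma> i\<close> of the
  column plus the part of the rational function along the eigenvectors from index \<open>K\<close>
  on. Treating the factors as diagonal matrices bounds each part by \<open>\<epsilon>\<close> for
  all columns at once, without a factor depending on \<open>k\<close>.\<close>

lemma projected_eigenvectors_bound: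
  fixes R Y S :: "real mat"
  assumes R: "R \<in> carrier_mat m m"
    and Rc: "\<And>u. u \<in> carrier_vec m \<Longrightarrow> (R *\<^sub>v u) \<bullet> (R *\<^sub>v u) \<le> u \<bullet> u"
    and Y: "Y \<in> carrier_mat m k"
    and Yc: "\<And>u. u \<in> carrier_vec k \<Longrightarrow> (Y *\<^sub>v u) \<bullet> (Y *\<^sub>v u) \<le> u \<bullet> u"
    and S: "S \<in> carrier_mat m m" "transpose_mat S * S = 1\<^sub>m m"
    and \<sigma>: "\<And>i. i < k \<Longrightarrow> \<bar>1 - \<sigma> i\<bar> \<le> \<epsilon>"
    and \<rho>: "\<And>j. j < m \<Longrightarrow> K \<le> j \<Longrightarrow> \<bar>\<rho> j\<bar> \<le> \<epsilon>" and \<epsilon>: "0 \<le> \<epsilon>"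
    and RS: "\<And>j. j < m \<Longrightarrow> j < K \<Longrightarrow> R *\<^sub>v col S j = 0\<^sub>v m"
    and Rres: "\<And>i. i < k \<Longrightarrow>
      R *\<^sub>v (\<sigma> i \<cdot>\<^sub>v col Y i - (S * mat_diag m \<rho> * transpose_mat S) *\<^sub>v col Y i) = 0\<^sub>v m"
    and x: "x \<in> carrier_vec k" "x \<bullet> x \<le> 1"
  shows "sqrt ((R *\<^sub>v (Y *\<^sub>v x)) \<bullet> (R *\<^sub>v (Y *\<^sub>v x))) \<le> 2 * \<epsilon>"
proof -
  have ST: "transpose_mat S \<in> carrier_mat m m" using S(1) by simp
  have SST: "S * transpose_mat S = 1\<^sub>m m"
    using mat_mult_left_right_inverse[OF ST S] .
  have Dc: "mat_diag a g \<in> carrier_mat a a" for a and g :: "nat \<Rightarrow> real" by simp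
  define D1 where "D1 = mat_diag k (\<lambda>i. 1 - \<sigma> i)"
  \<comment> \<open>The diagonal entries below \<open>K\<close> may be replaced by zero because they
    meet columns of \<open>S\<close> that \<open>R\<close> annihilates; hence
    \<open>R * M = R * N\<close>.\<close>
  define D2 where "D2 = mat_diag m (\<lambda>j. if j < K then 0 else \<rho> j)"
  have D1: "D1 \<in> carrier_mat k k" and D2: "D2 \<in> carrier_mat m m" by (simp_all add: D1_def D2_def)
  define N where "N = S * D2 * transpose_mat S"
  define M where "M = S * mat_diag m \<rho> * transpose_mat S"
  have N: "N \<in> carrier_mat m m" unfolding N_def by (intro mult_carrier_mat[of _ m m] S D2 ST)
  have M: "M \<in> carrier_mat m m" unfolding M_def by (intro mult_carrier_mat[of _ m m] S Dc ST)
  have "R * S * mat_diag m \<rho> = R * S * D2"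
  proof (rule eq_matI)
    fix i j assume "i < dim_row (R * S * D2)" "j < dim_col (R * S * D2)"
    then have ij: "i < m" "j < m" using R D2 by auto
    have RS': "R * S \<in> carrier_mat m m" using R S by simp
    have "(R * S) $$ (i, j) = (R *\<^sub>v col S j) $ i" using ij R S by simp
    also have "\<dots> = 0" if "j < K" using RS[OF ij(2) that] ij by simp
    finally show "(R * S * mat_diag m \<rho>) $$ (i, j) = (R * S * D2) $$ (i, j)"
      using ij by (simp add: D2_def mat_diag_mult_right[OF RS'])
  qed (use R D2 in \<open>auto simp: mat_diag_def\<close>)
  then have "R * S * mat_diag m \<rho> * transpose_mat S = R * S * D2 * transpose_mat S" by simp
  then have "R * M = R * N"
    unfolding M_def N_def using R S(1) D2 ST Dc[of m \<rho>]
    by (simp add: assoc_mult_mat[of _ m m _ m _ m])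
  \<comment> \<open>Split column \<open>c\<close> as (1 - \<open>\<sigma> j\<close>)
    \<open>c\<close> + \<open>\<sigma> j\<close> \<open>c\<close>; under \<open>R\<close> the second
    part equals \<open>M *\<^sub>v c\<close> by \<open>Rres\<close>, and then
    \<open>N *\<^sub>v c\<close>.\<close>
  have "R * Y = R * (Y * D1) + R * (N * Y)"
  proof (rule eq_matI)
    fix i j assume "i < dim_row (R * (Y * D1) + R * (N * Y))" "j < dim_col (R * (Y * D1) + R * (N * Y))"
    then have ij: "i < m" "j < k" using R Y D1 by auto
    define c where "c = col Y j"
    have c: "c \<in> carrier_vec m" using Y ij by (simp add: c_def)
    have RMN: "R *\<^sub>v (M *\<^sub>v c) = R *\<^sub>v (N *\<^sub>v c)"
      using \<open>R * M = R * N\<close> assoc_mult_mat_vec[OF R M c] assoc_mult_mat_vec[OF R N c] by simp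
    have Mc: "M *\<^sub>v c \<in> carrier_vec m" using M c by simp
    have "R *\<^sub>v (\<sigma> j \<cdot>\<^sub>v c - M *\<^sub>v c) = \<sigma> j \<cdot>\<^sub>v (R *\<^sub>v c) - R *\<^sub>v (M *\<^sub>v c)"
      using R c Mc by (simp add: mult_minus_distrib_mat_vec[of _ m m] mult_mat_vec[of _ m m])
    then have "(\<sigma> j \<cdot>\<^sub>v (R *\<^sub>v c) - R *\<^sub>v (N *\<^sub>v c)) $ i = 0\<^sub>v m $ i"
      using Rres[OF ij(2)] by (simp add: c_def M_def RMN[unfolded c_def M_def])
    then have eq: "\<sigma> j * (R *\<^sub>v c) $ i = (R *\<^sub>v (N *\<^sub>v c)) $ i"
      using ij R by (simp del: index_mult_mat_vec)
    have colD: "col (Y * D1) j = (1 - \<sigma> j) \<cdot>\<^sub>v c"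
      unfolding D1_def mat_diag_mult_right[OF Y] c_def using ij Y by (intro eq_vecI) auto
    have "(R * Y) $$ (i, j) = (R *\<^sub>v c) $ i" using ij R Y by (simp add: c_def)
    moreover have "(R * (Y * D1)) $$ (i, j) = (R *\<^sub>v col (Y * D1) j) $ i" using ij R Y D1 by simp
    moreover have "(R *\<^sub>v col (Y * D1) j) $ i = (1 - \<sigma> j) * (R *\<^sub>v c) $ i"
      unfolding colD mult_mat_vec[OF R c] using ij R by simp
    moreover have "(R * (N * Y)) $$ (i, j) = (R *\<^sub>v (N *\<^sub>v c)) $ i"
      using ij R Y N col_mult2[OF N Y ij(2)] by (simp add: c_def)
    moreover have "(R * (Y * D1) + R * (N * Y)) $$ (i, j)
        = (R * (Y * D1)) $$ (i, j) + (R * (N * Y)) $$ (i, j)"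
      using ij R Y N by simp
    ultimately show "(R * Y) $$ (i, j) = (R * (Y * D1) + R * (N * Y)) $$ (i, j)"
      using eq by (simp add: algebra_simps del: index_mult_mat_vec index_mult_mat index_add_mat)
  qed (use R Y D1 N in auto)
  then have sum: "(R * Y) *\<^sub>v x = (R * (Y * D1)) *\<^sub>v x + (R * (N * Y)) *\<^sub>v x"
    using R Y D1 N x by (simp add: add_mult_distrib_mat_vec[of _ m k])
  define u where "u = D1 *\<^sub>v x"
  define w where "w = D2 *\<^sub>v (transpose_mat S *\<^sub>v (Y *\<^sub>v x))"
  have u: "u \<in> carrier_vec k" using D1 x by (simp add: u_def)
  have Yx: "Y *\<^sub>v x \<in> carrier_vec m" using Y x by simp
  have STYx: "transpose_mat S *\<^sub>v (Y *\<^sub>v x) \<in> carrier_vec m" using ST Yx by simp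
  have w: "w \<in> carrier_vec m" using D2 STYx by (simp add: w_def)
  have Yu: "Y *\<^sub>v u \<in> carrier_vec m" using Y u by simp
  have Sw: "S *\<^sub>v w \<in> carrier_vec m" using S w by simp
  have e1: "(R * (Y * D1)) *\<^sub>v x = R *\<^sub>v (Y *\<^sub>v u)"
    unfolding u_def using R Y D1 x
    by (simp add: assoc_mult_mat_vec[of _ m m _ k] assoc_mult_mat_vec[of _ m k _ k])
  have "N *\<^sub>v (Y *\<^sub>v x) = S *\<^sub>v w"
    unfolding N_def w_def using S(1) D2 ST Yx STYx
    by (simp add: assoc_mult_mat_vec[of _ m m _ m])
  then have e2: "(R * (N * Y)) *\<^sub>v x = R *\<^sub>v (S *\<^sub>v w)"
    using R N Y x by (simp add: assoc_mult_mat_vec[of _ m m _ k])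
  have e3: "(R * Y) *\<^sub>v x = R *\<^sub>v (Y *\<^sub>v x)" using R Y x by simp
  have split: "R *\<^sub>v (Y *\<^sub>v x) = R *\<^sub>v (Y *\<^sub>v u) + R *\<^sub>v (S *\<^sub>v w)"
    using sum unfolding e1 e2 e3 .
  have xx: "sqrt (x \<bullet> x) \<le> 1" using x(2) by simp
  \<comment> \<open>The first part: \<open>R\<close> and \<open>Y\<close> are contractions, and
    \<open>D1\<close> has entries of size at most \<open>\<epsilon>\<close>.\<close>
  have "sqrt ((R *\<^sub>v (Y *\<^sub>v u)) \<bullet> (R *\<^sub>v (Y *\<^sub>v u))) \<le> sqrt (u \<bullet> u)"
    using Rc[OF Yu] Yc[OF u] by (intro real_sqrt_le_mono) linarith
  also have "\<dots> \<le> \<epsilon> * sqrt (x \<bullet> x)"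
    unfolding u_def D1_def by (rule mat_diag_l2norm_le[OF x(1) \<sigma> \<epsilon>])
  also have "\<dots> \<le> \<epsilon>" using xx \<epsilon> by (simp add: mult_left_le)
  finally have b1: "sqrt ((R *\<^sub>v (Y *\<^sub>v u)) \<bullet> (R *\<^sub>v (Y *\<^sub>v u))) \<le> \<epsilon>" .
  \<comment> \<open>The second part: \<open>S\<close> and its transpose preserve norms, so again
    only the diagonal factor \<open>D2\<close> matters.\<close>
  have "sqrt ((R *\<^sub>v (S *\<^sub>v w)) \<bullet> (R *\<^sub>v (S *\<^sub>v w))) \<le> sqrt (w \<bullet> w)"
    using Rc[OF Sw] isometry_scalar_prod[OF S w] by (intro real_sqrt_le_mono) linarith
  also have "\<dots> \<le> \<epsilon> * sqrt ((transpose_mat S *\<^sub>v (Y *\<^sub>v x)) \<bullet> (transpose_mat S *\<^sub>v (Y *\<^sub>v x)))"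
    unfolding w_def D2_def using \<rho> \<epsilon> by (intro mat_diag_l2norm_le[OF STYx]) auto
  also have "(transpose_mat S *\<^sub>v (Y *\<^sub>v x)) \<bullet> (transpose_mat S *\<^sub>v (Y *\<^sub>v x)) = (Y *\<^sub>v x) \<bullet> (Y *\<^sub>v x)"
    by (rule isometry_scalar_prod[OF ST _ Yx]) (simp add: SST)
  also have "\<epsilon> * sqrt \<dots> \<le> \<epsilon> * 1"
    using Yc[OF x(1)] x(2) \<epsilon> by (intro mult_left_mono) auto
  finally have b2: "sqrt ((R *\<^sub>v (S *\<^sub>v w)) \<bullet> (R *\<^sub>v (S *\<^sub>v w))) \<le> \<epsilon>" by simp
  show ?thesis
    unfolding split using l2norm_triangle[of "R *\<^sub>v (Y *\<^sub>v u)" m "R *\<^sub>v (S *\<^sub>v w)"] b1 b2 R Yu Sw by simp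
qed

section \<open>Eigenbases, block matrices and subspaces\<close>

lemma zero_mat_mult_vec:
  fixes v :: "real vec"
  assumes "v \<in> carrier_vec nc"
  shows "0\<^sub>m nr nc *\<^sub>v v = 0\<^sub>v nr"
  using assms by (intro eq_vecI) auto

text \<open>The first form feeds the calculus of rational functions, the second the interlacing
  argument.\<close>

lemma eigenbasis_diagonalizes:
  fixes T S :: "real mat"
  assumes T: "T \<in> carrier_mat m m" and S: "S \<in> carrier_mat m m" "transpose_mat S * S = 1\<^sub>m m"
    and eig: "\<And>j. j < m \<Longrightarrow> T *\<^sub>v col S j = \<theta> j \<cdot>\<^sub>v col S j"
  shows "transpose_mat S * T = mat_diag m \<theta> * transpose_mat S"
    and "transpose_mat S * T * S = mat_diag m \<theta>"
proof -
  have ST: "transpose_mat S \<in> carrier_mat m m" using S(1) by simp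
  have SST: "S * transpose_mat S = 1\<^sub>m m"
    using mat_mult_left_right_inverse[OF ST S] .
  have D: "mat_diag m \<theta> \<in> carrier_mat m m" by simp
  have TS: "T * S = S * mat_diag m \<theta>"
  proof (rule eq_matI)
    fix i j assume "i < dim_row (S * mat_diag m \<theta>)" "j < dim_col (S * mat_diag m \<theta>)"
    then have ij: "i < m" "j < m" using S D by auto
    have "(T * S) $$ (i, j) = (T *\<^sub>v col S j) $ i" using ij T S by simp
    then show "(T * S) $$ (i, j) = (S * mat_diag m \<theta>) $$ (i, j)"
      unfolding eig[OF ij(2)] using ij S by (simp add: mat_diag_mult_right[OF S(1)])
  qed (use T S in \<open>auto simp: mat_diag_def\<close>)
  have "transpose_mat S * T * S = transpose_mat S * (T * S)"
    by (rule assoc_mult_mat[OF ST T S(1)])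
  also have "\<dots> = transpose_mat S * S * mat_diag m \<theta>"
    unfolding TS by (rule assoc_mult_mat[OF ST S(1) D, symmetric])
  finally show STS: "transpose_mat S * T * S = mat_diag m \<theta>" using D by (simp add: S(2))
  have STT: "transpose_mat S * T \<in> carrier_mat m m" using ST T by simp
  have "transpose_mat S * T = transpose_mat S * T * (S * transpose_mat S)"
    using right_mult_one_mat[OF STT] by (simp only: SST)
  also have "\<dots> = transpose_mat S * T * S * transpose_mat S"
    by (rule assoc_mult_mat[OF STT S(1) ST, symmetric])
  finally show "transpose_mat S * T = mat_diag m \<theta> * transpose_mat S" unfolding STS .
qed

text \<open>Stacking the eigenvectors of the leading block on top of zeros gives orthonormal columns
  \<open>Q\<close>, and the compression of \<open>A\<close> to them is the diagonalized leading
  block.\<close>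

lemma cauchy_interlacing_le:
  fixes T S A B C D :: "real mat"
  assumes blocks: "T \<in> carrier_mat m m" "B \<in> carrier_mat m r" "C \<in> carrier_mat r m" "D \<in> carrier_mat r r"
    and A: "A = four_block_mat T B C D" and sym: "transpose_mat A = A"
    and cp: "char_poly A = (\<Prod>e\<leftarrow>es. [:- e, 1:])" and es: "sorted es"
    and S: "S \<in> carrier_mat m m" "transpose_mat S * S = 1\<^sub>m m"
      "transpose_mat S * T * S = mat_diag m \<theta>"
    and \<theta>: "mono_on {..<m} \<theta>" and j: "j < m"
  shows "es ! j \<le> \<theta> j"
proof -
  have Ac: "A \<in> carrier_mat (m + r) (m + r)" using blocks by (simp add: A)
  have "degree (\<Prod>e\<leftarrow>es. [:- e, 1:]) = length es"
    by (rule degree_linear_factors)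
  then have len: "length es = m + r" using degree_monic_char_poly[OF Ac] cp by simp
  obtain U where U: "U \<in> carrier_mat (m + r) (m + r)" "transpose_mat U * U = 1\<^sub>m (m + r)"
      "transpose_mat U * A * U = mat_diag (m + r) (\<lambda>i. es ! i)"
    using symmetric_orthogonal_diagonalization[OF Ac sym cp] by blast
  \<comment> \<open>Blocks without columns allow the tall matrix to be written as
    \<open>four_block_mat\<close>, so that block multiplication applies.\<close>
  define Q where "Q = four_block_mat S (0\<^sub>m m 0) (0\<^sub>m r m) (0\<^sub>m r 0)"
  have Q: "Q \<in> carrier_mat (m + r) m"
    using four_block_carrier_mat[OF S(1), of "0\<^sub>m r 0" r 0] by (simp add: Q_def)
  have QT: "transpose_mat Q = four_block_mat (transpose_mat S) (0\<^sub>m m r) (0\<^sub>m 0 m) (0\<^sub>m 0 r)"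
    unfolding Q_def by (subst transpose_four_block_mat[of _ m m _ 0 _ r]) (use S in auto)
  have empty: "four_block_mat X (0\<^sub>m m 0) (0\<^sub>m 0 m) (0\<^sub>m 0 0) = X" 
    if "X \<in> carrier_mat m m" for X :: "real mat"
    by (rule eq_matI) (use that in auto)
  have "transpose_mat Q * Q = transpose_mat S * S"
    unfolding QT unfolding Q_def
    by (subst mult_four_block_mat[of _ m m _ r _ 0 _ _ m _ 0]) (use S in \<open>auto simp: empty\<close>)
  then have QQ: "transpose_mat Q * Q = 1\<^sub>m m" using S by simp
  have "transpose_mat Q * A = four_block_mat (transpose_mat S * T) (transpose_mat S * B) (0\<^sub>m 0 m) (0\<^sub>m 0 r)"
    unfolding QT A
    by (subst mult_four_block_mat[of _ m m _ r _ 0 _ _ m _ r]) (use S(1) blocks in auto)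
  also have "\<dots> * Q = four_block_mat (transpose_mat S * T * S) (0\<^sub>m m 0) (0\<^sub>m 0 m) (0\<^sub>m 0 0)"
    unfolding Q_def
    by (subst mult_four_block_mat[of _ m m _ r _ 0 _ _ m _ 0]) (use S(1) blocks in auto)
  also have "\<dots> = mat_diag m \<theta>" unfolding S(3) by (rule empty) simp
  finally have QAQ: "transpose_mat Q * A * Q = mat_diag m \<theta>" .
  have "mono_on {..<m + r} (\<lambda>i. es ! i)"
    using es len by (intro mono_onI) (auto intro: sorted_nth_mono)
  from eigenvalue_compression_le[OF Ac U Q QQ QAQ this \<theta> j] j show ?thesis by simp
qed

lemma block_eigenvector_first:
  fixes T B C D :: "real mat"
  assumes blocks: "T \<in> carrier_mat m m" "B \<in> carrier_mat m r" "C \<in> carrier_mat r m" "D \<in> carrier_mat r r"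
    and w: "w \<in> carrier_vec (m + r)" and eig: "four_block_mat T B C D *\<^sub>v w = \<mu> \<cdot>\<^sub>v w"
  shows "T *\<^sub>v vec_first w m + B *\<^sub>v vec_last w r = \<mu> \<cdot>\<^sub>v vec_first w m"
proof -
  define a where "a = vec_first w m"
  define d where "d = vec_last w r"
  have wad: "w = a @\<^sub>v d" using w by (simp add: a_def d_def)
  have a: "a \<in> carrier_vec m" and d: "d \<in> carrier_vec r" by (simp_all add: a_def d_def)
  have "\<mu> \<cdot>\<^sub>v w = \<mu> \<cdot>\<^sub>v a @\<^sub>v \<mu> \<cdot>\<^sub>v d" unfolding wad by (rule eq_vecI) (use a d in auto)
  moreover have "four_block_mat T B C D *\<^sub>v w = (T *\<^sub>v a + B *\<^sub>v d) @\<^sub>v (C *\<^sub>v a + D *\<^sub>v d)"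
    unfolding wad by (rule four_block_mat_mult_vec[OF blocks a d])
  ultimately have "(T *\<^sub>v a + B *\<^sub>v d) @\<^sub>v (C *\<^sub>v a + D *\<^sub>v d) = \<mu> \<cdot>\<^sub>v a @\<^sub>v \<mu> \<cdot>\<^sub>v d"
    using eig by simp
  then have "T *\<^sub>v a + B *\<^sub>v d = \<mu> \<cdot>\<^sub>v a"
    using blocks a d by (subst (asm) append_vec_eq[of _ m]) auto
  then show ?thesis by (simp add: a_def d_def)
qed

lemma outer_prod_mult_vec:
  assumes "z \<in> carrier_vec (dim_vec v)"
  shows "outer_prod u v *\<^sub>v z = (v \<bullet> z) \<cdot>\<^sub>v u"
  using assms by (intro eq_vecI)
    (auto simp: outer_prod_def scalar_prod_def sum_distrib_left sum_distrib_right ac_simps)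

lemma vec_subspace_sumI: "u \<in> M \<Longrightarrow> w \<in> N \<Longrightarrow> u + w \<in> vec_subspace_sum m M N"
proof -
  interpret vec_space "TYPE(real)" m .
  assume "u \<in> M" "w \<in> N"
  then show ?thesis unfolding submodule_sum_def by (auto simp: module_vec_simps)
qed

text \<open>A vector of the span is \<open>V *\<^sub>v c\<close>, and orthonormality makes
  \<open>V * transpose_mat V\<close> fix it.\<close>

lemma projection_complement_kills:
  fixes V :: "real mat"
  assumes V: "V \<in> carrier_mat m l" "transpose_mat V * V = 1\<^sub>m l"
    and v: "v \<in> vec_span m (set (cols V))"
  shows "(1\<^sub>m m - V * transpose_mat V) *\<^sub>v v = 0\<^sub>v m"
proof -
  obtain c where c: "c \<in> carrier_vec l" "v = V *\<^sub>v c" using vec_span_colsE[OF V(1) v] .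
  have VT: "transpose_mat V \<in> carrier_mat l m" using V by simp
  have Vc: "V *\<^sub>v c \<in> carrier_vec m" using V c by simp
  have "(V * transpose_mat V) *\<^sub>v v = V *\<^sub>v (transpose_mat V *\<^sub>v (V *\<^sub>v c))"
    unfolding c(2) by (rule assoc_mult_mat_vec[OF V(1) VT Vc])
  also have "transpose_mat V *\<^sub>v (V *\<^sub>v c) = c"
    using assoc_mult_mat_vec[OF VT V(1) c(1)] c(1) by (simp add: V(2))
  finally have "(V * transpose_mat V) *\<^sub>v v = v" using c by simp
  then show ?thesis using Vc V VT
    by (subst minus_mult_distrib_mat_vec[of _ m m]) (auto simp: c(2))
qed

text \<open>The zero numerator yields the zero vector. It serves to place the span of eigenvectors
  inside the subspace sum.\<close>

lemma zero_in_rational_krylov: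
  assumes T: "T \<in> carrier_mat m m" and S: "S \<in> carrier_mat m m" "transpose_mat S * S = 1\<^sub>m m"
    and TS: "transpose_mat S * T = mat_diag m \<theta> * transpose_mat S"
    and q: "\<And>i. i < m \<Longrightarrow> poly q (\<theta> i) \<noteq> 0" and e: "e \<in> carrier_vec m"
  shows "0\<^sub>v m \<in> rational_krylov T e p q"
proof -
  have "mat_diag m (\<lambda>i. poly 0 (\<theta> i) / poly q (\<theta> i)) = 0\<^sub>m m m"
    by (rule eq_matI) (auto simp: mat_diag_def)
  then have "(poly_mat 0 T * the (mat_inverse (poly_mat q T))) *\<^sub>v e = 0\<^sub>v m"
    using S e by (simp add: rational_mat_diagonalized[OF T S TS q] zero_mat_mult_vec[of _ m])
  then show ?thesis unfolding rational_krylov_def by (auto intro!: exI[of _ 0])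
qed

text \<open>The supremum is the least upper bound; the zero vector shows that the set is
  nonempty.\<close>

lemma spectral_norm_le:
  assumes "\<And>x. x \<in> carrier_vec (dim_col A) \<Longrightarrow> x \<bullet> x \<le> 1 \<Longrightarrow> sqrt ((A *\<^sub>v x) \<bullet> (A *\<^sub>v x)) \<le> b"
  shows "spectral_norm A \<le> b"
  unfolding spectral_norm_def
  by (rule cSup_least) (use assms in \<open>auto intro!: exI[of _ "0\<^sub>v (dim_col A)"]\<close>)

lemma scalar_prod_vec_first_le:
  fixes w :: "real vec"
  assumes "w \<in> carrier_vec (m + r)"
  shows "vec_first w m \<bullet> vec_first w m \<le> w \<bullet> w"
proof -
  have "w \<bullet> w = (vec_first w m @\<^sub>v vec_last w r) \<bullet> (vec_first w m @\<^sub>v vec_last w r)"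
    using assms by simp
  also have "\<dots> = vec_first w m \<bullet> vec_first w m + vec_last w r \<bullet> vec_last w r"
    by (rule scalar_prod_append[of _ m _ r]) auto
  finally show ?thesis using scalar_prod_self_nonneg[of "vec_last w r"] by simp
qed

text \<open>The identity block of \<open>P\<close> reproduces the last \<open>r\<close> entries
  exactly, so the complementary projection acts on the first \<open>m\<close> entries alone.\<close>

lemma block_projection_complement:
  fixes V :: "real mat"
  assumes V: "V \<in> carrier_mat m l" and w: "w \<in> carrier_vec (m + r)"
  defines "P \<equiv> four_block_mat V (0\<^sub>m m r) (0\<^sub>m r l) (1\<^sub>m r)"
  shows "(1\<^sub>m (m + r) - P * transpose_mat P) *\<^sub>v w
    = ((1\<^sub>m m - V * transpose_mat V) *\<^sub>v vec_first w m) @\<^sub>v 0\<^sub>v r"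
proof -
  have VT: "transpose_mat V \<in> carrier_mat l m" using V by simp
  have VV: "V * transpose_mat V \<in> carrier_mat m m" using V by simp
  define R where "R = 1\<^sub>m m - V * transpose_mat V"
  have R: "R \<in> carrier_mat m m" unfolding R_def using VV by (rule minus_carrier_mat)
  have PT: "transpose_mat P = four_block_mat (transpose_mat V) (0\<^sub>m l r) (0\<^sub>m r m) (1\<^sub>m r)"
    unfolding P_def by (subst transpose_four_block_mat[of _ m l _ r _ r]) (use V in auto)
  have "P * transpose_mat P = four_block_mat (V * transpose_mat V) (0\<^sub>m m r) (0\<^sub>m r m) (1\<^sub>m r)"
    unfolding PT unfolding P_def
    by (subst mult_four_block_mat[of _ m l _ r _ r _ _ m _ r]) (use V VT VV in auto)
  then have "1\<^sub>m (m + r) - P * transpose_mat P = four_block_mat R (0\<^sub>m m r) (0\<^sub>m r m) (0\<^sub>m r r)"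
    using VV by (intro eq_matI) (auto simp: R_def)
  moreover have "w = vec_first w m @\<^sub>v vec_last w r" using w by simp
  ultimately have "(1\<^sub>m (m + r) - P * transpose_mat P) *\<^sub>v w
    = four_block_mat R (0\<^sub>m m r) (0\<^sub>m r m) (0\<^sub>m r r) *\<^sub>v (vec_first w m @\<^sub>v vec_last w r)" by simp
  also have "\<dots> = (R *\<^sub>v vec_first w m + 0\<^sub>m m r *\<^sub>v vec_last w r) @\<^sub>v
       (0\<^sub>m r m *\<^sub>v vec_first w m + 0\<^sub>m r r *\<^sub>v vec_last w r)"
    by (rule four_block_mat_mult_vec[OF R]) auto
  also have "\<dots> = (R *\<^sub>v vec_first w m) @\<^sub>v 0\<^sub>v r"
    using R by (simp add: zero_mat_mult_vec[of _ m] zero_mat_mult_vec[of _ r])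
  finally show ?thesis unfolding R_def .
qed

section \<open>The estimate for the coupled block matrix\<close>

theorem theorem2p6:
  fixes m n k khat l :: nat
    and Tn Tm S W V P :: "real mat"
    and \<beta> tol \<tau> :: real
    and s :: "nat \<Rightarrow> real vec"
    and \<theta> lam :: "nat \<Rightarrow> real"
    and p q :: "real poly"
  assumes "1 \<le> m" and "m < n"
    and "Tm \<in> carrier_mat m m" and "S \<in> carrier_mat (n - m) (n - m)"
    and "transpose_mat S = S"
    and "transpose_mat Tn = Tn"
    and "Tn = four_block_mat Tm (0\<^sub>m m (n - m)) (0\<^sub>m (n - m) m) S
            + \<beta> \<cdot>\<^sub>m four_block_mat
                (0\<^sub>m m m) (outer_prod (unit_vec m (m - 1)) (unit_vec (n - m) 0))
                (outer_prod (unit_vec (n - m) 0) (unit_vec m (m - 1))) (0\<^sub>m (n - m) (n - m))"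
    (* eigenpairs of Tm *)
    and "\<forall>i\<in>{1..m}. eigenvector Tm (s i) (\<theta> i)"
    and "\<forall>i\<in>{1..m}. \<forall>j\<in>{1..m}. s i \<bullet> s j = (if i = j then 1 else 0)"
    and "mono_on {1..m} \<theta>"
    (* all eigenvalues of Tn, counted with multiplicity, in increasing order *)
    and "char_poly Tn = (\<Prod>i\<in>{1..n}. [:- lam i, 1:])"
    and "mono_on {1..n} lam"
    and "W \<in> carrier_mat n k" and "orthonormal_cols W"
    and "\<forall>i\<in>{1..k}. eigenvector Tn (col W (i - 1)) (lam i)"
    and "0 < tol" and "tol < 1"
    and "1 \<le> k" and "k \<le> khat" and "khat \<le> m - 1"
    and "\<theta> k < \<theta> (khat + 1)"
    and "\<tau> = (\<theta> k + \<theta> (khat + 1)) / 2"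
    and "q \<noteq> 0"
    and "\<forall>x. poly q x = 0 \<longrightarrow> \<not> eigenvalue Tm x \<and> \<not> eigenvalue Tn x"
    (* the first conjunct says that r = p / q is defined at x *)
    and "\<forall>x\<in>{lam 1..\<theta> m} - {\<theta> k<..<\<theta> (khat + 1)}.
           poly q x \<noteq> 0 \<and> \<bar>poly p x / poly q x - step_fun \<tau> x\<bar> < tol"
    and "num_poles p q \<le> m"
    and "vec_subspace_dim m (rational_krylov Tm (unit_vec m (m - 1)) p q) = num_poles p q"
    and "V \<in> carrier_mat m l" and "orthonormal_cols V"
    and "vec_span m (set (cols V)) =
           vec_subspace_sum m (vec_span m (s ` {1..khat}))
             (rational_krylov Tm (unit_vec m (m - 1)) p q)"
    and "P = four_block_mat V (0\<^sub>m m (n - m)) (0\<^sub>m (n - m) l) (1\<^sub>m (n - m))"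
  shows "spectral_norm ((1\<^sub>m n - P * transpose_mat P) * W) < 2 * tol"
proof -
  note m = assms(1) and mn = assms(2) and Tm = assms(3) and Sc = assms(4)
    and Tn_sym = assms(6) and Tn = assms(7)
    and s_eig = assms(8) and s_orth = assms(9) and \<theta>_mono = assms(10)
    and cp = assms(11) and lam_mono = assms(12)
    and W = assms(13) and W_orth = assms(14) and W_eig = assms(15)
    and k1 = assms(18) and kkhat = assms(19) and khat = assms(20)
    and gap = assms(21) and \<tau> = assms(22) and q_roots = assms(24) and approx = assms(25)
    and V = assms(28) and V_orth = assms(29) and span = assms(30) and P = assms(31)
  define r where "r = n - m"
  have r: "n = m + r" "0 < r" using mn by (auto simp: r_def)
  let ?rat = "\<lambda>x. poly p x / poly q x"
  let ?e = "unit_vec m (m - 1) :: real vec"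
  let ?Q = "rational_krylov Tm ?e p q"
  let ?U = "vec_span m (s ` {1..khat})"
  have e: "?e \<in> carrier_vec m" by simp
  \<comment> \<open>Eigenvalues are numbered from 1 in the statement, columns and list entries from
    0; \<open>th\<close> and \<open>es\<close> carry out the shift.\<close>
  define th where "th = (\<lambda>j. \<theta> (Suc j))"
  define es where "es = map lam [1..<Suc n]"
  define B where "B = \<beta> \<cdot>\<^sub>m outer_prod ?e (unit_vec r 0)"
  define C where "C = \<beta> \<cdot>\<^sub>m outer_prod (unit_vec r 0) ?e"
  have B: "B \<in> carrier_mat m r" and C: "C \<in> carrier_mat r m"
    by (simp_all add: B_def C_def outer_prod_def)
  have S: "S \<in> carrier_mat r r" using Sc by (simp add: r_def)
  note blocks = Tm B C S
  have Tn': "Tn = four_block_mat Tm B C S"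
    unfolding Tn r_def[symmetric]
    by (rule eq_matI) (use Tm S in \<open>auto simp: B_def C_def outer_prod_def\<close>)

  \<comment> \<open>Eigenbasis of the leading block\<close>
  define Sm where "Sm = mat m m (\<lambda>(i, j). s (Suc j) $ i)"
  have s: "s i \<in> carrier_vec m" "Tm *\<^sub>v s i = \<theta> i \<cdot>\<^sub>v s i" if "i \<in> {1..m}" for i
    using s_eig that Tm unfolding eigenvector_def by auto
  have Sm: "Sm \<in> carrier_mat m m" by (simp add: Sm_def)
  have col_Sm: "col Sm j = s (Suc j)" if "j < m" for j
    using s(1)[of "Suc j"] that by (intro eq_vecI) (auto simp: Sm_def)
  have Sm_orth: "transpose_mat Sm * Sm = 1\<^sub>m m"
  proof (rule eq_matI)
    fix i j assume "i < dim_row (1\<^sub>m m :: real mat)" "j < dim_col (1\<^sub>m m :: real mat)"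
    then have ij: "i < m" "j < m" by auto
    have "(transpose_mat Sm * Sm) $$ (i, j) = col Sm i \<bullet> col Sm j" using ij Sm by simp
    also have "\<dots> = 1\<^sub>m m $$ (i, j)" using s_orth ij by (auto simp: col_Sm)
    finally show "(transpose_mat Sm * Sm) $$ (i, j) = 1\<^sub>m m $$ (i, j)" .
  qed (use Sm in auto)
  have Sm_eig: "Tm *\<^sub>v col Sm j = th j \<cdot>\<^sub>v col Sm j" if "j < m" for j
    using s(2)[of "Suc j"] that by (simp add: col_Sm th_def)
  have diag: "transpose_mat Sm * Tm = mat_diag m th * transpose_mat Sm"
    "transpose_mat Sm * Tm * Sm = mat_diag m th"
    using eigenbasis_diagonalizes[OF Tm Sm Sm_orth] Sm_eig by blast+
  have th_mono: "mono_on {..<m} th"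
    unfolding th_def using \<theta>_mono by (intro mono_onI) (auto intro: mono_onD)

  \<comment> \<open>Interlacing of the eigenvalues\<close>
  have "char_poly Tn = (\<Prod>i\<leftarrow>[1..<Suc n]. [:- lam i, 1:])"
    unfolding cp using prod.distinct_set_conv_list[of "[1..<Suc n]" "\<lambda>i. [:- lam i, 1:]"]
    by (simp add: atLeastLessThanSuc_atLeastAtMost del: upt_Suc)
  then have cp': "char_poly Tn = (\<Prod>e\<leftarrow>es. [:- e, 1:])"
    by (simp add: es_def comp_def del: upt_Suc)
  have es_nth: "es ! j = lam (Suc j)" if "j < n" for j
    using that by (simp add: es_def del: upt_Suc)
  have es: "sorted es"
    unfolding sorted_iff_nth_mono
    by (auto simp: es_nth es_def simp del: upt_Suc intro!: mono_onD[OF lam_mono])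
  have interlace: "lam i \<le> \<theta> i" if "i \<in> {1..m}" for i
    using cauchy_interlacing_le[OF blocks Tn' Tn_sym cp' es Sm Sm_orth diag(2) th_mono, of "i - 1"]
      es_nth[of "i - 1"] that mn by (auto simp: th_def)

  \<comment> \<open>Approximation of the step function at the eigenvalues\<close>
  have \<theta>_le: "\<theta> i \<le> \<theta> j" if "1 \<le> i" "i \<le> j" "j \<le> m" for i j
    using that by (intro mono_onD[OF \<theta>_mono]) auto
  have lam_le: "lam i \<le> lam j" if "1 \<le> i" "i \<le> j" "j \<le> n" for i j
    using that by (intro mono_onD[OF lam_mono]) auto
  have km: "k < m" "khat < m" using k1 kkhat khat m by auto
  \<comment> \<open>Interlacing gives \<open>lam i\<close> \<le> \<open>\<theta> i\<close> \<le>
    \<open>\<theta> k\<close>, which is below the midpoint \<open>\<tau>\<close>, so the step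
    function is 1 there.\<close>
  have low: "poly q (lam i) \<noteq> 0 \<and> \<bar>?rat (lam i) - 1\<bar> < tol" if "i \<in> {1..k}" for i
  proof -
    have "lam 1 \<le> lam i" using that km mn by (intro lam_le) auto
    moreover have "lam i \<le> \<theta> k"
      using interlace[of i] \<theta>_le[of i k] that km by auto
    moreover have "\<theta> k \<le> \<theta> m" using k1 km by (intro \<theta>_le) auto
    ultimately have "lam i \<in> {lam 1..\<theta> m} - {\<theta> k<..<\<theta> (khat + 1)}" "lam i < \<tau>"
      using gap \<tau> by auto
    with bspec[OF approx this(1)] show ?thesis by (simp add: step_fun_def)
  qed
  \<comment> \<open>These eigenvalues lie at or above the right end of the gap, where the step
    function is 0; interlacing at index 1 puts them above \<open>lam 1\<close>.\<close>
  have high: "\<bar>?rat (\<theta> j)\<bar> < tol" if "j \<in> {khat + 1..m}" for j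
  proof -
    have "\<theta> (khat + 1) \<le> \<theta> j" using that by (intro \<theta>_le) auto
    moreover have "\<theta> j \<le> \<theta> m" using that by (intro \<theta>_le) auto
    moreover have "lam 1 \<le> \<theta> j" using interlace[of 1] \<theta>_le[of 1 j] that m by auto
    ultimately have "\<theta> j \<in> {lam 1..\<theta> m} - {\<theta> k<..<\<theta> (khat + 1)}" "\<not> \<theta> j < \<tau>"
      using gap \<tau> by auto
    with bspec[OF approx this(1)] show ?thesis by (simp add: step_fun_def)
  qed
  \<comment> \<open>The approximation hypothesis does not settle this: eigenvalues with index
    between \<open>k\<close> and \<open>khat\<close> may lie inside the gap. The condition on the
    zeros of \<open>q\<close> does.\<close>
  have q_th: "poly q (th j) \<noteq> 0" if "j < m" for j
    using q_roots s_eig that unfolding eigenvalue_def th_def by (metis Suc_leI atLeastAtMost_iff le_add1 plus_1_eq_Suc)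

  \<comment> \<open>Only finitely many errors occur, so their maximum \<open>\<epsilon>\<close> is
    still strictly below \<open>tol\<close>. This keeps the final inequality strict after passing to
    a supremum.\<close>
  define errs where "errs = (\<lambda>i. \<bar>?rat (lam i) - 1\<bar>) ` {1..k} \<union> (\<lambda>j. \<bar>?rat (\<theta> j)\<bar>) ` {khat + 1..m}"
  define \<epsilon> where "\<epsilon> = Max errs"
  have errs: "finite errs" "errs \<noteq> {}" using k1 by (auto simp: errs_def)
  have \<epsilon>_tol: "\<epsilon> < tol"
    unfolding \<epsilon>_def using errs low high by (subst Max_less_iff) (auto simp: errs_def)
  have \<epsilon>_ge: "x \<le> \<epsilon>" if "x \<in> errs" for x
    unfolding \<epsilon>_def using errs that by simp
  have \<epsilon>0: "0 \<le> \<epsilon>"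
    using \<epsilon>_ge[of "\<bar>?rat (lam 1) - 1\<bar>"] k1 by (force simp: errs_def)

  \<comment> \<open>The complementary projection annihilates the search space\<close>
  have VV: "transpose_mat V * V = 1\<^sub>m l" using V V_orth by (simp add: orthonormal_cols_def)
  define R where "R = 1\<^sub>m m - V * transpose_mat V"
  have R: "R \<in> carrier_mat m m"
    unfolding R_def using V by (intro minus_carrier_mat mult_carrier_mat[of _ m l]) auto
  have R_kills: "R *\<^sub>v v = 0\<^sub>v m" if "v \<in> vec_subspace_sum m ?U ?Q" for v
    unfolding R_def using that by (intro projection_complement_kills[OF V VV]) (simp add: span)
  have s_carrier: "s ` {1..khat} \<subseteq> carrier_vec m" using s(1) km by auto
  have RSm: "R *\<^sub>v col Sm j = 0\<^sub>v m" if j: "j < khat" for j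
  proof -
    interpret vec_space "TYPE(real)" m .
    have "s (Suc j) \<in> ?U" using in_own_span[OF s_carrier] j by auto
    moreover have "0\<^sub>v m \<in> ?Q" by (rule zero_in_rational_krylov[OF Tm Sm Sm_orth diag(1) q_th e])
    ultimately have "s (Suc j) + 0\<^sub>v m \<in> vec_subspace_sum m ?U ?Q" by (rule vec_subspace_sumI)
    then show ?thesis using R_kills[of "s (Suc j)"] s(1)[of "Suc j"] j km by (simp add: col_Sm)
  qed
  have RQ: "R *\<^sub>v v = 0\<^sub>v m" if v: "v \<in> ?Q" "v \<in> carrier_vec m" for v
  proof -
    interpret vec_space "TYPE(real)" m .
    have "s 1 \<in> ?U" using in_own_span[OF s_carrier] k1 kkhat by auto
    \<comment> \<open>Zero is produced as a multiple of \<open>s 1\<close>, which is available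
      because \<open>khat\<close> is at least 1.\<close>
    from smult_in_span[OF s_carrier this, of 0] have "0 \<cdot>\<^sub>v s 1 \<in> ?U" .
    also have "0 \<cdot>\<^sub>v s 1 = 0\<^sub>v m" using s(1)[of 1] m by (intro eq_vecI) auto
    finally have "0\<^sub>v m \<in> ?U" .
    from vec_subspace_sumI[OF this v(1)] show ?thesis using R_kills[of v] v(2) by simp
  qed

  \<comment> \<open>Leading parts of the eigenvectors and their Krylov residuals\<close>
  define Y where "Y = mat m k (\<lambda>(i, j). W $$ (i, j))"
  have Y: "Y \<in> carrier_mat m k" by (simp add: Y_def)
  have WW: "transpose_mat W * W = 1\<^sub>m k" using W W_orth by (simp add: orthonormal_cols_def)
  have Yx: "Y *\<^sub>v x = vec_first (W *\<^sub>v x) m" if "x \<in> carrier_vec k" for x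
    using that W r by (intro eq_vecI) (auto simp: Y_def vec_first_def scalar_prod_def)
  have Wx: "W *\<^sub>v x \<in> carrier_vec (m + r)" if "x \<in> carrier_vec k" for x
    using W that r by simp
  have Yc: "(Y *\<^sub>v x) \<bullet> (Y *\<^sub>v x) \<le> x \<bullet> x" if "x \<in> carrier_vec k" for x
    unfolding Yx[OF that] using scalar_prod_vec_first_le[OF Wx[OF that]]
      isometry_scalar_prod[OF W WW that] by simp
  define M where "M = Sm * mat_diag m (\<lambda>j. ?rat (th j)) * transpose_mat Sm"
  have res: "R *\<^sub>v (?rat (lam (Suc i)) \<cdot>\<^sub>v col Y i - M *\<^sub>v col Y i) = 0\<^sub>v m" if i: "i < k" for i
  proof (rule RQ)
    define w where "w = col W i"
    have w: "w \<in> carrier_vec (m + r)" using W i r by (simp add: w_def)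
    have "four_block_mat Tm B C S *\<^sub>v w = lam (Suc i) \<cdot>\<^sub>v w"
      using W_eig[rule_format, of "Suc i"] i unfolding eigenvector_def w_def Tn'[symmetric] by simp
    from block_eigenvector_first[OF blocks w this]
    have eq: "Tm *\<^sub>v vec_first w m + B *\<^sub>v vec_last w r = lam (Suc i) \<cdot>\<^sub>v vec_first w m" .
    have col_Y: "vec_first w m = col Y i"
      unfolding w_def using W i r by (intro eq_vecI) (auto simp: Y_def vec_first_def)
    \<comment> \<open>The coupling block has rank at most one and maps everything to multiples of
      the last unit vector, the starting vector of the Krylov space.\<close>
    have "B *\<^sub>v vec_last w r = \<beta> \<cdot>\<^sub>v (outer_prod ?e (unit_vec r 0) *\<^sub>v vec_last w r)"
      unfolding B_def by (rule eq_vecI) (auto simp: outer_prod_def scalar_prod_def sum_distrib_left mult.assoc)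
    also have "\<dots> = (\<beta> * (unit_vec r 0 \<bullet> vec_last w r)) \<cdot>\<^sub>v ?e"
      by (subst outer_prod_mult_vec) (auto simp: smult_smult_assoc)
    finally have "Tm *\<^sub>v col Y i + (\<beta> * (unit_vec r 0 \<bullet> vec_last w r)) \<cdot>\<^sub>v ?e = lam (Suc i) \<cdot>\<^sub>v col Y i"
      using eq unfolding col_Y by simp
    moreover have "poly q (lam (Suc i)) \<noteq> 0" using low[of "Suc i"] i by auto
    moreover have cY: "col Y i \<in> carrier_vec m" using Y i by simp
    ultimately show "?rat (lam (Suc i)) \<cdot>\<^sub>v col Y i - M *\<^sub>v col Y i \<in> ?Q"
      unfolding M_def using rational_residual_in_krylov[OF Tm Sm Sm_orth diag(1) q_th _ _ e] by blast
    have "M \<in> carrier_mat m m"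
      unfolding M_def using Sm by (intro mult_carrier_mat[of _ m m]) auto
    then show "?rat (lam (Suc i)) \<cdot>\<^sub>v col Y i - M *\<^sub>v col Y i \<in> carrier_vec m" using cY by simp
  qed

  \<comment> \<open>The norm estimate\<close>
  have "spectral_norm ((1\<^sub>m n - P * transpose_mat P) * W) \<le> 2 * \<epsilon>"
  proof (rule spectral_norm_le)
    fix x :: "real vec"
    assume "x \<in> carrier_vec (dim_col ((1\<^sub>m n - P * transpose_mat P) * W))" and x1: "x \<bullet> x \<le> 1"
    then have x: "x \<in> carrier_vec k" using W by simp
    have RYx: "R *\<^sub>v (Y *\<^sub>v x) \<in> carrier_vec m" using R Y x by simp
    have Pc: "1\<^sub>m n - P * transpose_mat P \<in> carrier_mat n n"
    proof -
      have "P \<in> carrier_mat (m + r) (l + r)"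
        unfolding P r_def[symmetric] by (rule four_block_carrier_mat[OF V]) simp
      then show ?thesis by (intro minus_carrier_mat) (simp add: r)
    qed
    have "((1\<^sub>m n - P * transpose_mat P) * W) *\<^sub>v x = (1\<^sub>m n - P * transpose_mat P) *\<^sub>v (W *\<^sub>v x)"
      by (rule assoc_mult_mat_vec[OF Pc W x])
    also have "\<dots> = (R *\<^sub>v (Y *\<^sub>v x)) @\<^sub>v 0\<^sub>v r"
      using block_projection_complement[OF V Wx[OF x]] r(1) unfolding P R_def Yx[OF x] by simp
    finally have eq: "((1\<^sub>m n - P * transpose_mat P) * W) *\<^sub>v x = (R *\<^sub>v (Y *\<^sub>v x)) @\<^sub>v 0\<^sub>v r" .
    have norm: "(((1\<^sub>m n - P * transpose_mat P) * W) *\<^sub>v x) \<bullet> (((1\<^sub>m n - P * transpose_mat P) * W) *\<^sub>v x)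
        = (R *\<^sub>v (Y *\<^sub>v x)) \<bullet> (R *\<^sub>v (Y *\<^sub>v x))"
      unfolding eq using scalar_prod_append[OF RYx zero_carrier_vec RYx zero_carrier_vec, of r] by simp
    show "sqrt ((((1\<^sub>m n - P * transpose_mat P) * W) *\<^sub>v x) \<bullet> (((1\<^sub>m n - P * transpose_mat P) * W) *\<^sub>v x)) \<le> 2 * \<epsilon>"
      unfolding norm
    proof (rule projected_eigenvectors_bound[OF R _ Y Yc Sm Sm_orth _ _ \<epsilon>0 _ _ x x1])
      show "(R *\<^sub>v u) \<bullet> (R *\<^sub>v u) \<le> u \<bullet> u" if "u \<in> carrier_vec m" for u
        unfolding R_def by (rule projection_complement_contracts[OF V VV that])
      show "\<bar>1 - ?rat (lam (Suc i))\<bar> \<le> \<epsilon>" if "i < k" for i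
        using \<epsilon>_ge[of "\<bar>?rat (lam (Suc i)) - 1\<bar>"] that by (auto simp: errs_def abs_minus_commute)
      show "\<bar>?rat (th j)\<bar> \<le> \<epsilon>" if "j < m" "khat \<le> j" for j
        using that by (intro \<epsilon>_ge) (auto simp: errs_def th_def)
      show "R *\<^sub>v col Sm j = 0\<^sub>v m" if "j < m" "j < khat" for j
        using RSm that(2) .
      show "R *\<^sub>v (?rat (lam (Suc i)) \<cdot>\<^sub>v col Y i
          - (Sm * mat_diag m (\<lambda>j. ?rat (th j)) * transpose_mat Sm) *\<^sub>v col Y i) = 0\<^sub>v m" if "i < k" for i
        using res[OF that] unfolding M_def .
    qed
  qed
  then show ?thesis using \<epsilon>_tol by simp
qed

end
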